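(* The semigroup $\mathscr{PO}_\infty(\mathbb{N}^2_\leqslant)/\sigma$ is isomorphic to the semidirect product $\mathfrak{AM}_\omega\rtimes_{\mathfrak{Q}}\mathbb{Z}_2$ of the free commutative monoid $\mathfrak{AM}_\omega$ over an infinite countable set by the cyclic group $\mathbb{Z}_2$ of order two, where $\mathfrak{AM}_\omega$ is the free commutative monoid on the set $\{a_i : i\in\mathbb{N}\}\cup\{b_j : j\in\mathbb{N}\}$ of pairwise distinct generators, and $\mathfrak{Q}\colon\mathbb{Z}_2=\{\bar 0,\bar 1\}\to\operatorname{Aut}(\mathfrak{AM}_\omega)$ sends $\bar 0$ to the identity and $\bar 1$ to the automorphism $\mathfrak{f}$ given by $(a_1^{i_1}\cdots a_k^{i_k}b_1^{j_1}\cdots b_l^{j_l})\mathfrak{f}=a_1^{j_1}\cdots a_l^{j_l}b_1^{i_1}\cdots b_k^{i_k}$ for non-negative integer exponents.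
   Context: $\mathbb{N}$ is the set of positive integers with its usual order, and $\mathbb{N}^2_\leqslant$ is $\mathbb{N}\times\mathbb{N}$ with the product order: $(i,m)\leqslant(j,n)$ iff $i\le j$ and $m\le n$. Partial maps are written on the right and composed left to right: $x(\alpha\beta)=(x\alpha)\beta$, with $\operatorname{dom}(\alpha\beta)=\{y\in\operatorname{dom}\alpha : y\alpha\in\operatorname{dom}\beta\}$. A partial map $\alpha\colon X\rightharpoonup X$ of a poset is monotone if $x\leqslant y$ implies $(x)\alpha\leqslant(y)\alpha$ for all $x,y\in\operatorname{dom}\alpha$. $\mathscr{PO}_\infty(\mathbb{N}^2_\leqslant)$ is the monoid, under composition, of all injective monotone partial selfmaps $\alpha$ of $\mathbb{N}^2_\leqslant$ such that $\operatorname{dom}\alpha$ and $\operatorname{ran}\alpha$ have finite complement in $\mathbb{N}\times\mathbb{N}$. $E(S)$ denotes the set of idempotents of a semigroup $S$. The relation $\sigma$ on $\mathscr{PO}_\infty(\mathbb{N}^2_\leqslant)$ is defined by: $\alpha\sigma\beta$ iff there exists $\varepsilon\in E(\mathscr{PO}_\infty(\mathbb{N}^2_\leqslant))$ with $\alpha\varepsilon=\beta\varepsilon$; it is a congruence. For semigroups $S,T$ and a homomorphism $\mathfrak{H}\colon T\to\operatorname{End}(S)$, $t\mapsto\mathfrak{h}_t$, the semidirect product $S\rtimes_{\mathfrak{H}}T$ is $S\times T$ with the operation $(s_1,t_1)\cdot(s_2,t_2)=(s_1\cdot(s_2)\mathfrak{h}_{t_1},\,t_1t_2)$. *)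

theory Defs
  imports
    "HOL-Algebra.Bij"
    "HOL-Algebra.Elementary_Groups"
    "HOL-Library.Multiset"
    "HOL-Library.Product_Order"
begin

section \<open>Semigroup notions\<close>

text \<open>
  Semigroups are represented by the \<^type>\<open>monoid\<close> records of HOL-Algebra.  The notion of isomorphism
  \<open>\<cong>\<close> of that library (a bijection of the carriers preserving the multiplication) does not refer to
  the unit, hence is the semigroup one.
\<close>

definition idempotents :: "('a, 'b) monoid_scheme \<Rightarrow> 'a set" where
  "idempotents S = {e \<in> carrier S. e \<otimes>\<^bsub>S\<^esub> e = e}"

text \<open>
  The product of two classes is the union of the classes of all products of representatives; if
  \<open>r\<close> is a congruence, this is the class of the product of any two representatives (see
  \<open>PO_quotient_mult\<close> below for the case of interest).
\<close>

definition quotient_semigroup :: "('a, 'b) monoid_scheme \<Rightarrow> ('a \<times> 'a) set \<Rightarrow> 'a set monoid" where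
  "quotient_semigroup S r =
    \<lparr>carrier = carrier S // r,
     monoid.mult = (\<lambda>A B. \<Union>x\<in>A. \<Union>y\<in>B. r `` {x \<otimes>\<^bsub>S\<^esub> y}),
     one = r `` {\<one>\<^bsub>S\<^esub>}\<rparr>"

definition semidirect_product ::
    "('a, 'c) monoid_scheme \<Rightarrow> ('b, 'd) monoid_scheme \<Rightarrow> ('b \<Rightarrow> 'a \<Rightarrow> 'a) \<Rightarrow> ('a \<times> 'b) monoid" where
  "semidirect_product S T h =
    \<lparr>carrier = carrier S \<times> carrier T,
     monoid.mult = (\<lambda>(s\<^sub>1, t\<^sub>1) (s\<^sub>2, t\<^sub>2). (s\<^sub>1 \<otimes>\<^bsub>S\<^esub> h t\<^sub>1 s\<^sub>2, t\<^sub>1 \<otimes>\<^bsub>T\<^esub> t\<^sub>2)),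
     one = (\<one>\<^bsub>S\<^esub>, \<one>\<^bsub>T\<^esub>)\<rparr>"

text \<open>The free commutative monoid over a set \<open>A\<close>: finite multisets of elements of \<open>A\<close>.\<close>

definition free_comm_monoid :: "'a set \<Rightarrow> 'a multiset monoid" where
  "free_comm_monoid A = \<lparr>carrier = {M. set_mset M \<subseteq> A}, monoid.mult = (+), one = {#}\<rparr>"


section \<open>Cofinite monotone injective partial selfmaps of the plane grid\<close>

definition posnat :: "nat set" where
  "posnat = {n. 0 < n}"

text \<open>The order on pairs is the componentwise one of \<^theory>\<open>HOL-Library.Product_Order\<close>.\<close>

definition PO_maps :: "(nat \<times> nat \<rightharpoonup> nat \<times> nat) set" where
  "PO_maps = {\<alpha>. dom \<alpha> \<subseteq> posnat \<times> posnat \<and> ran \<alpha> \<subseteq> posnat \<times> posnat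
      \<and> inj_on \<alpha> (dom \<alpha>)
      \<and> mono_on (dom \<alpha>) (\<lambda>x. the (\<alpha> x))
      \<and> finite (posnat \<times> posnat - dom \<alpha>) \<and> finite (posnat \<times> posnat - ran \<alpha>)}"

text \<open>
  Maps act on the right: \<open>\<alpha> \<otimes> \<beta>\<close> applies \<open>\<alpha>\<close> first, whereas \<open>\<beta> \<circ>\<^sub>m \<alpha>\<close> is written in the usual
  functional order.
\<close>

definition PO :: "(nat \<times> nat \<rightharpoonup> nat \<times> nat) monoid" where
  "PO = \<lparr>carrier = PO_maps, monoid.mult = (\<lambda>\<alpha> \<beta>. \<beta> \<circ>\<^sub>m \<alpha>), one = Some |` (posnat \<times> posnat)\<rparr>"

definition sigma :: "((nat \<times> nat \<rightharpoonup> nat \<times> nat) \<times> (nat \<times> nat \<rightharpoonup> nat \<times> nat)) set" where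
  "sigma = {(\<alpha>, \<beta>). \<alpha> \<in> carrier PO \<and> \<beta> \<in> carrier PO \<and>
      (\<exists>\<epsilon> \<in> idempotents PO. \<alpha> \<otimes>\<^bsub>PO\<^esub> \<epsilon> = \<beta> \<otimes>\<^bsub>PO\<^esub> \<epsilon>)}"


section \<open>The free commutative monoid on the letters and the action of the cyclic group of order two\<close>

datatype letter = gen_a nat | gen_b nat

definition AM :: "letter multiset monoid" where
  "AM = free_comm_monoid (gen_a ` posnat \<union> gen_b ` posnat)"

primrec swap_letter :: "letter \<Rightarrow> letter" where
  "swap_letter (gen_a i) = gen_b i"
| "swap_letter (gen_b j) = gen_a j"

definition AM_swap :: "letter multiset \<Rightarrow> letter multiset" where
  "AM_swap = (\<lambda>M \<in> carrier AM. image_mset swap_letter M)"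

definition Q_action :: "int \<Rightarrow> letter multiset \<Rightarrow> letter multiset" where
  "Q_action t = (if t = 0 then (\<lambda>M \<in> carrier AM. M) else AM_swap)"


section \<open>Well-definedness\<close>

lemma PO_simps:
  "carrier PO = PO_maps" "\<alpha> \<otimes>\<^bsub>PO\<^esub> \<beta> = \<beta> \<circ>\<^sub>m \<alpha>" "\<one>\<^bsub>PO\<^esub> = Some |` (posnat \<times> posnat)"
  by (simp_all add: PO_def)

lemma PO_maps_inj: "\<alpha> \<in> PO_maps \<Longrightarrow> \<alpha> x = Some z \<Longrightarrow> \<alpha> y = Some z \<Longrightarrow> x = y"
  unfolding PO_maps_def by (metis (mono_tags, lifting) domI inj_onD mem_Collect_eq)

lemma PO_maps_finite_vimage:
  assumes "\<alpha> \<in> PO_maps" "finite F"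
  shows "finite {x. \<exists>y\<in>F. \<alpha> x = Some y}"
proof -
  have "inj_on \<alpha> {x. \<exists>y\<in>F. \<alpha> x = Some y}"
    using PO_maps_inj[OF assms(1)] by (auto simp: inj_on_def)
  moreover have "\<alpha> ` {x. \<exists>y\<in>F. \<alpha> x = Some y} \<subseteq> Some ` F"
    by auto
  ultimately show ?thesis
    using assms(2) by (meson finite_imageI finite_imageD finite_subset)
qed

lemma PO_maps_comp:
  assumes A: "\<alpha> \<in> PO_maps" and B: "\<beta> \<in> PO_maps"
  shows "\<beta> \<circ>\<^sub>m \<alpha> \<in> PO_maps"
proof -
  let ?N = "posnat \<times> posnat"
  have dA: "dom \<alpha> \<subseteq> ?N" "ran \<alpha> \<subseteq> ?N" "finite (?N - dom \<alpha>)" "finite (?N - ran \<alpha>)"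
    and dB: "dom \<beta> \<subseteq> ?N" "ran \<beta> \<subseteq> ?N" "finite (?N - dom \<beta>)" "finite (?N - ran \<beta>)"
    using A B by (auto simp: PO_maps_def)
  have "dom (\<beta> \<circ>\<^sub>m \<alpha>) \<subseteq> ?N"
    using dA(1) by (auto simp: map_comp_Some_iff dom_def)
  moreover have "ran (\<beta> \<circ>\<^sub>m \<alpha>) \<subseteq> ?N"
    using dB(2) by (fastforce simp: map_comp_Some_iff ran_def)
  moreover have "inj_on (\<beta> \<circ>\<^sub>m \<alpha>) (dom (\<beta> \<circ>\<^sub>m \<alpha>))"
  proof (rule inj_onI)
    fix x y assume "x \<in> dom (\<beta> \<circ>\<^sub>m \<alpha>)" and eq: "(\<beta> \<circ>\<^sub>m \<alpha>) x = (\<beta> \<circ>\<^sub>m \<alpha>) y"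
    then obtain z where z: "(\<beta> \<circ>\<^sub>m \<alpha>) x = Some z" by blast
    with eq have z': "(\<beta> \<circ>\<^sub>m \<alpha>) y = Some z" by (rule subst)
    obtain u where "\<alpha> x = Some u" "\<beta> u = Some z" using z unfolding map_comp_Some_iff by blast
    moreover obtain u' where "\<alpha> y = Some u'" "\<beta> u' = Some z" using z' unfolding map_comp_Some_iff by blast
    ultimately show "x = y" using PO_maps_inj[OF A] PO_maps_inj[OF B] by metis
  qed
  moreover have "mono_on (dom (\<beta> \<circ>\<^sub>m \<alpha>)) (\<lambda>x. the ((\<beta> \<circ>\<^sub>m \<alpha>) x))"
  proof (rule mono_onI)
    fix x y assume x: "x \<in> dom (\<beta> \<circ>\<^sub>m \<alpha>)" and y: "y \<in> dom (\<beta> \<circ>\<^sub>m \<alpha>)" and "x \<le> y"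
    then obtain u v u' v' where *: "\<alpha> x = Some u" "\<beta> u = Some v" "\<alpha> y = Some u'" "\<beta> u' = Some v'"
      unfolding dom_def not_None_eq mem_Collect_eq map_comp_Some_iff by blast
    have mono: "mono_on (dom \<alpha>) (\<lambda>x. the (\<alpha> x))" "mono_on (dom \<beta>) (\<lambda>x. the (\<beta> x))"
      using A B by (auto simp: PO_maps_def)
    have "the (\<alpha> x) \<le> the (\<alpha> y)"
      by (rule mono_onD[OF mono(1)]) (use * \<open>x \<le> y\<close> in blast)+
    then have "u \<le> u'" by (simp only: * option.sel)
    have "the (\<beta> u) \<le> the (\<beta> u')"
      by (rule mono_onD[OF mono(2)]) (use * \<open>u \<le> u'\<close> in blast)+
    then have "v \<le> v'" by (simp only: * option.sel)
    with * show "the ((\<beta> \<circ>\<^sub>m \<alpha>) x) \<le> the ((\<beta> \<circ>\<^sub>m \<alpha>) y)"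
      by simp
  qed
  moreover have "finite (?N - dom (\<beta> \<circ>\<^sub>m \<alpha>))"
  proof (rule finite_subset)
    show "?N - dom (\<beta> \<circ>\<^sub>m \<alpha>) \<subseteq> (?N - dom \<alpha>) \<union> {x. \<exists>y\<in>?N - dom \<beta>. \<alpha> x = Some y}"
    proof
      fix x assume x: "x \<in> ?N - dom (\<beta> \<circ>\<^sub>m \<alpha>)"
      show "x \<in> (?N - dom \<alpha>) \<union> {x. \<exists>y\<in>?N - dom \<beta>. \<alpha> x = Some y}"
      proof (cases "\<alpha> x")
        case None with x show ?thesis by auto
      next
        case (Some y)
        then have "y \<in> ?N" using dA(2) by (meson ranI subsetD)
        moreover have "y \<notin> dom \<beta>" using x Some by (auto simp: dom_def)
        ultimately show ?thesis using Some by auto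
      qed
    qed
  qed (use dA dB PO_maps_finite_vimage[OF A] in auto)
  moreover have "finite (?N - ran (\<beta> \<circ>\<^sub>m \<alpha>))"
  proof (rule finite_subset)
    show "?N - ran (\<beta> \<circ>\<^sub>m \<alpha>) \<subseteq> (?N - ran \<beta>) \<union> (\<lambda>x. the (\<beta> x)) ` (?N - ran \<alpha>)"
    proof
      fix z assume z: "z \<in> ?N - ran (\<beta> \<circ>\<^sub>m \<alpha>)"
      show "z \<in> (?N - ran \<beta>) \<union> (\<lambda>x. the (\<beta> x)) ` (?N - ran \<alpha>)"
      proof (cases "z \<in> ran \<beta>")
        case False with z show ?thesis by auto
      next
        case True
        then obtain y where y: "\<beta> y = Some z" by (auto simp: ran_def)
        then have "y \<in> ?N" using dB(1) by auto
        moreover have "y \<notin> ran \<alpha>"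
        proof
          assume "y \<in> ran \<alpha>"
          then obtain x where "\<alpha> x = Some y" unfolding ran_def by blast
          then have "(\<beta> \<circ>\<^sub>m \<alpha>) x = Some z" using y by simp
          with z show False by (blast intro: ranI)
        qed
        moreover have "z = the (\<beta> y)" using y by simp
        ultimately show ?thesis by blast
      qed
    qed
  qed (use dA dB in auto)
  ultimately show ?thesis by (simp add: PO_maps_def)
qed

lemma PO_maps_restrict_Some:
  assumes "D \<subseteq> posnat \<times> posnat" "finite (posnat \<times> posnat - D)"
  shows "Some |` D \<in> PO_maps"
proof -
  have "dom (Some |` D) = D" "ran (Some |` D) = D"
    by (auto simp: dom_def ran_def restrict_map_def)
  then show ?thesis
    using assms by (auto simp: PO_maps_def inj_on_def mono_on_def restrict_map_def)
qed

lemma monoid_PO: "monoid PO"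
proof (rule monoidI)
  fix \<alpha> \<beta> \<gamma> assume "\<alpha> \<in> carrier PO"
  then have d: "dom \<alpha> \<subseteq> posnat \<times> posnat" "ran \<alpha> \<subseteq> posnat \<times> posnat" by (auto simp: PO_simps PO_maps_def)
  show "\<one>\<^bsub>PO\<^esub> \<otimes>\<^bsub>PO\<^esub> \<alpha> = \<alpha>"
  proof
    fix x show "(\<one>\<^bsub>PO\<^esub> \<otimes>\<^bsub>PO\<^esub> \<alpha>) x = \<alpha> x"
      using d(1) by (cases "\<alpha> x") (auto simp: PO_simps map_comp_def restrict_map_def)
  qed
  show "\<alpha> \<otimes>\<^bsub>PO\<^esub> \<one>\<^bsub>PO\<^esub> = \<alpha>"
  proof
    fix x show "(\<alpha> \<otimes>\<^bsub>PO\<^esub> \<one>\<^bsub>PO\<^esub>) x = \<alpha> x"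
      using d(2) by (cases "\<alpha> x") (auto simp: PO_simps map_comp_def restrict_map_def dest: ranI)
  qed
  show "(\<alpha> \<otimes>\<^bsub>PO\<^esub> \<beta>) \<otimes>\<^bsub>PO\<^esub> \<gamma> = \<alpha> \<otimes>\<^bsub>PO\<^esub> (\<beta> \<otimes>\<^bsub>PO\<^esub> \<gamma>)"
    by (auto simp: PO_simps map_comp_def fun_eq_iff split: option.splits)
qed (auto simp: PO_simps PO_maps_comp PO_maps_restrict_Some)

lemma restrict_Some_idempotent:
  assumes "D \<subseteq> posnat \<times> posnat" "finite (posnat \<times> posnat - D)"
  shows "Some |` D \<in> idempotents PO"
  using PO_maps_restrict_Some[OF assms]
  by (auto simp: idempotents_def PO_simps map_comp_def restrict_map_def fun_eq_iff)

lemma idempotent_PO_fixes: "\<epsilon> \<in> idempotents PO \<Longrightarrow> \<epsilon> x = Some y \<Longrightarrow> y = x"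
proof -
  assume e: "\<epsilon> \<in> idempotents PO" and xy: "\<epsilon> x = Some y"
  from e have "\<epsilon> \<in> PO_maps" "\<epsilon> \<circ>\<^sub>m \<epsilon> = \<epsilon>" by (simp_all add: idempotents_def PO_simps)
  moreover from this(2) xy have "\<epsilon> y = Some y" by (metis map_comp_simps(2))
  ultimately show "y = x" using xy PO_maps_inj by blast
qed

lemma sigma_iff_finite:
  "(\<alpha>, \<beta>) \<in> sigma \<longleftrightarrow> \<alpha> \<in> PO_maps \<and> \<beta> \<in> PO_maps \<and> finite {x. \<alpha> x \<noteq> \<beta> x}"
proof (intro iffI conjI)
  assume *: "(\<alpha>, \<beta>) \<in> sigma"
  then show A: "\<alpha> \<in> PO_maps" and B: "\<beta> \<in> PO_maps" by (auto simp: sigma_def PO_simps)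
  obtain \<epsilon> where e: "\<epsilon> \<in> idempotents PO" "\<epsilon> \<circ>\<^sub>m \<alpha> = \<epsilon> \<circ>\<^sub>m \<beta>"
    using * by (auto simp: sigma_def PO_simps)
  let ?F = "posnat \<times> posnat - dom \<epsilon>"
  have F: "finite ?F" using e(1) by (auto simp: idempotents_def PO_simps PO_maps_def)
  have key: "\<gamma> x = Some y \<Longrightarrow> y \<in> dom \<epsilon> \<Longrightarrow> (\<epsilon> \<circ>\<^sub>m \<gamma>) x = Some y" for \<gamma> :: "nat \<times> nat \<rightharpoonup> nat \<times> nat" and x y
    using idempotent_PO_fixes[OF e(1)] unfolding map_comp_Some_iff dom_def by fastforce
  have key': "(\<epsilon> \<circ>\<^sub>m \<gamma>) x = Some y \<Longrightarrow> \<gamma> x = Some y" for \<gamma> :: "nat \<times> nat \<rightharpoonup> nat \<times> nat" and x y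
    using idempotent_PO_fixes[OF e(1)] unfolding map_comp_Some_iff by metis
  have "{x. \<alpha> x \<noteq> \<beta> x} \<subseteq> {x. \<exists>y\<in>?F. \<alpha> x = Some y} \<union> {x. \<exists>y\<in>?F. \<beta> x = Some y}"
  proof
    fix x assume x: "x \<in> {x. \<alpha> x \<noteq> \<beta> x}"
    have "ran \<alpha> \<subseteq> posnat \<times> posnat" "ran \<beta> \<subseteq> posnat \<times> posnat" using A B by (auto simp: PO_maps_def)
    moreover have "y \<notin> dom \<epsilon>" if "\<alpha> x = Some y \<or> \<beta> x = Some y" for y
    proof
      assume "y \<in> dom \<epsilon>"
      with that have "(\<epsilon> \<circ>\<^sub>m \<alpha>) x = Some y"
        using key e(2) by metis
      then have "\<alpha> x = Some y" "\<beta> x = Some y"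
        using key' e(2) by metis+
      with x show False by simp
    qed
    moreover obtain y where "\<alpha> x = Some y \<or> \<beta> x = Some y"
      using x by (cases "\<alpha> x"; cases "\<beta> x") auto
    ultimately show "x \<in> {x. \<exists>y\<in>?F. \<alpha> x = Some y} \<union> {x. \<exists>y\<in>?F. \<beta> x = Some y}"
      by (blast dest: ranI)
  qed
  then show "finite {x. \<alpha> x \<noteq> \<beta> x}"
    using PO_maps_finite_vimage[OF A F] PO_maps_finite_vimage[OF B F] finite_subset by blast
next
  assume *: "\<alpha> \<in> PO_maps \<and> \<beta> \<in> PO_maps \<and> finite {x. \<alpha> x \<noteq> \<beta> x}"
  define F where "F = (\<lambda>x. the (\<alpha> x)) ` {x. \<alpha> x \<noteq> \<beta> x} \<union> (\<lambda>x. the (\<beta> x)) ` {x. \<alpha> x \<noteq> \<beta> x}"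
  let ?e = "Some |` (posnat \<times> posnat - F)"
  have "finite (posnat \<times> posnat - (posnat \<times> posnat - F))"
    by (rule finite_subset[of _ F]) (use * in \<open>auto simp: F_def\<close>)
  then have "?e \<in> idempotents PO" by (intro restrict_Some_idempotent) auto
  moreover have "?e \<circ>\<^sub>m \<alpha> = ?e \<circ>\<^sub>m \<beta>"
  proof
    fix x
    show "(?e \<circ>\<^sub>m \<alpha>) x = (?e \<circ>\<^sub>m \<beta>) x"
    proof (cases "\<alpha> x = \<beta> x")
      case True then show ?thesis by (simp add: map_comp_def)
    next
      case False
      then have "the (\<alpha> x) \<in> F" "the (\<beta> x) \<in> F"
        by (auto simp only: F_def)
      then show ?thesis by (cases "\<alpha> x"; cases "\<beta> x") (auto simp: map_comp_def)
    qed
  qed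
  ultimately show "(\<alpha>, \<beta>) \<in> sigma"
    using * by (auto simp: sigma_def PO_simps)
qed

lemma equiv_sigma: "equiv (carrier PO) sigma"
proof (rule equivI)
  show "sigma \<subseteq> carrier PO \<times> carrier PO" by (auto simp: sigma_def)
  show "refl_on (carrier PO) sigma" by (auto simp: refl_on_def sigma_iff_finite PO_simps)
  show "sym sigma" by (auto simp: sym_def sigma_iff_finite eq_commute)
  show "trans sigma"
  proof (rule transI)
    fix \<alpha> \<beta> \<gamma> assume "(\<alpha>, \<beta>) \<in> sigma" "(\<beta>, \<gamma>) \<in> sigma"
    moreover have "{x. \<alpha> x \<noteq> \<gamma> x} \<subseteq> {x. \<alpha> x \<noteq> \<beta> x} \<union> {x. \<beta> x \<noteq> \<gamma> x}" by auto
    ultimately show "(\<alpha>, \<gamma>) \<in> sigma"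
      by (auto simp: sigma_iff_finite intro: finite_subset)
  qed
qed

lemma sigma_congruence:
  assumes "(\<alpha>, \<alpha>') \<in> sigma" "(\<beta>, \<beta>') \<in> sigma"
  shows "(\<alpha> \<otimes>\<^bsub>PO\<^esub> \<beta>, \<alpha>' \<otimes>\<^bsub>PO\<^esub> \<beta>') \<in> sigma"
proof -
  have *: "\<alpha> \<in> PO_maps" "\<alpha>' \<in> PO_maps" "\<beta> \<in> PO_maps" "\<beta>' \<in> PO_maps"
    "finite {x. \<alpha> x \<noteq> \<alpha>' x}" "finite {x. \<beta> x \<noteq> \<beta>' x}"
    using assms by (auto simp: sigma_iff_finite)
  have "{x. (\<beta> \<circ>\<^sub>m \<alpha>) x \<noteq> (\<beta>' \<circ>\<^sub>m \<alpha>') x}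
      \<subseteq> {x. \<alpha> x \<noteq> \<alpha>' x} \<union> {x. \<exists>y\<in>{y. \<beta> y \<noteq> \<beta>' y}. \<alpha> x = Some y}"
  proof
    fix x assume "x \<in> {x. (\<beta> \<circ>\<^sub>m \<alpha>) x \<noteq> (\<beta>' \<circ>\<^sub>m \<alpha>') x}"
    then show "x \<in> {x. \<alpha> x \<noteq> \<alpha>' x} \<union> {x. \<exists>y\<in>{y. \<beta> y \<noteq> \<beta>' y}. \<alpha> x = Some y}"
      unfolding map_comp_def by (cases "\<alpha> x = \<alpha>' x"; cases "\<alpha>' x") (simp_all del: split_paired_Ex)
  qed
  then have "finite {x. (\<beta> \<circ>\<^sub>m \<alpha>) x \<noteq> (\<beta>' \<circ>\<^sub>m \<alpha>') x}"
    using *(5) PO_maps_finite_vimage[OF *(1) *(6)] by (meson finite_UnI finite_subset)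
  then show ?thesis
    using * by (simp add: sigma_iff_finite PO_simps PO_maps_comp)
qed

lemma PO_quotient_mult:
  assumes "\<alpha> \<in> carrier PO" "\<beta> \<in> carrier PO"
  shows "sigma `` {\<alpha>} \<otimes>\<^bsub>quotient_semigroup PO sigma\<^esub> sigma `` {\<beta>} = sigma `` {\<alpha> \<otimes>\<^bsub>PO\<^esub> \<beta>}"
proof -
  have "sigma `` {x \<otimes>\<^bsub>PO\<^esub> y} = sigma `` {\<alpha> \<otimes>\<^bsub>PO\<^esub> \<beta>}" if "x \<in> sigma `` {\<alpha>}" "y \<in> sigma `` {\<beta>}" for x y
    using that sigma_congruence[of \<alpha> x \<beta> y] equiv_class_eq[OF equiv_sigma] by auto
  note key = this
  have mem: "\<alpha> \<in> sigma `` {\<alpha>}" "\<beta> \<in> sigma `` {\<beta>}"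
    using assms equiv_class_self[OF equiv_sigma] by auto
  have "sigma `` {\<alpha>} \<otimes>\<^bsub>quotient_semigroup PO sigma\<^esub> sigma `` {\<beta>}
      = (\<Union>x\<in>sigma `` {\<alpha>}. \<Union>y\<in>sigma `` {\<beta>}. sigma `` {x \<otimes>\<^bsub>PO\<^esub> y})"
    by (simp add: quotient_semigroup_def)
  also have "\<dots> = (\<Union>x\<in>sigma `` {\<alpha>}. \<Union>y\<in>sigma `` {\<beta>}. sigma `` {\<alpha> \<otimes>\<^bsub>PO\<^esub> \<beta>})"
    by (intro SUP_cong refl key)
  also have "\<dots> = sigma `` {\<alpha> \<otimes>\<^bsub>PO\<^esub> \<beta>}"
    using mem by blast
  finally show ?thesis .
qed

lemma AM_simps:
  "carrier AM = {M. set_mset M \<subseteq> gen_a ` posnat \<union> gen_b ` posnat}" "M \<otimes>\<^bsub>AM\<^esub> N = M + N" "\<one>\<^bsub>AM\<^esub> = {#}"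
  by (simp_all add: AM_def free_comm_monoid_def)

lemma swap_letter_swap_letter [simp]: "swap_letter (swap_letter g) = g"
  by (cases g) auto

lemma AM_swap_closed: "M \<in> carrier AM \<Longrightarrow> AM_swap M \<in> carrier AM"
  by (fastforce simp: AM_simps AM_swap_def)

lemma AM_swap_AM_swap: "M \<in> carrier AM \<Longrightarrow> AM_swap (AM_swap M) = M"
  using AM_swap_closed[of M]
  by (simp add: AM_swap_def multiset.map_comp comp_def)

text \<open>\<open>AM_swap\<close> exchanges the exponents of \<open>gen_a i\<close> and \<open>gen_b i\<close>.\<close>

lemma AM_swap_word:
  fixes p q :: "nat \<Rightarrow> nat"
  shows "AM_swap ((\<Sum>i=1..k. replicate_mset (p i) (gen_a i)) + (\<Sum>j=1..l. replicate_mset (q j) (gen_b j)))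
    = (\<Sum>j=1..l. replicate_mset (q j) (gen_a j)) + (\<Sum>i=1..k. replicate_mset (p i) (gen_b i))"
proof -
  have "(\<Sum>i=1..k. replicate_mset (p i) (gen_a i)) + (\<Sum>j=1..l. replicate_mset (q j) (gen_b j)) \<in> carrier AM"
    by (auto simp: AM_simps set_mset_sum posnat_def split: if_splits)
  moreover have "image_mset swap_letter (\<Sum>i\<in>I. f i) = (\<Sum>i\<in>I. image_mset swap_letter (f i))"
    if "finite I" for I and f :: "nat \<Rightarrow> letter multiset"
    using that by (induction I rule: finite_induct) auto
  ultimately show ?thesis
    by (simp add: AM_swap_def add.commute)
qed

lemma Q_action_hom: "Q_action \<in> hom (integer_mod_group 2) (AutoGroup AM)"
proof -
  have 1: "(\<lambda>M \<in> carrier AM. M) \<in> auto AM"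
    by (auto simp: auto_def hom_def Bij_def AM_simps bij_betw_def inj_on_def)
  have "bij_betw AM_swap (carrier AM) (carrier AM)"
    by (rule bij_betwI[where g = AM_swap]) (auto simp: AM_swap_closed AM_swap_AM_swap)
  moreover have "AM_swap \<in> hom AM AM"
    using AM_swap_closed by (auto simp: hom_def AM_simps AM_swap_def)
  ultimately have 2: "AM_swap \<in> auto AM"
    by (auto simp: auto_def Bij_def AM_swap_def)
  have B: "auto AM \<subseteq> Bij (carrier AM)" by (auto simp: auto_def)
  have c: "compose (carrier AM) AM_swap AM_swap = (\<lambda>M \<in> carrier AM. M)"
    "compose (carrier AM) AM_swap (\<lambda>M \<in> carrier AM. M) = AM_swap"
    "compose (carrier AM) (\<lambda>M \<in> carrier AM. M) AM_swap = AM_swap"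
    "compose (carrier AM) (\<lambda>M \<in> carrier AM. M) (\<lambda>M \<in> carrier AM. M) = (\<lambda>M \<in> carrier AM. M)"
    using AM_swap_closed AM_swap_AM_swap by (auto simp: compose_def fun_eq_iff AM_swap_def)
  have in_auto: "Q_action t \<in> auto AM" for t
    using 1 2 by (simp add: Q_action_def)
  have Z2: "t = 0 \<or> t = 1" if "t \<in> carrier (integer_mod_group 2)" for t
    using that by (auto simp: carrier_integer_mod_group)
  show ?thesis
  proof (rule homI)
    fix s t assume s: "s \<in> carrier (integer_mod_group 2)" and t: "t \<in> carrier (integer_mod_group 2)"
    have "Q_action s \<otimes>\<^bsub>AutoGroup AM\<^esub> Q_action t = compose (carrier AM) (Q_action s) (Q_action t)"
      using in_auto B by (simp add: AutoGroup_def BijGroup_def subset_iff)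
    also have "\<dots> = Q_action ((s + t) mod 2)"
      using Z2[OF s] Z2[OF t] by (elim disjE) (simp_all only: Q_action_def, simp_all add: c)
    finally show "Q_action (s \<otimes>\<^bsub>integer_mod_group 2\<^esub> t) = Q_action s \<otimes>\<^bsub>AutoGroup AM\<^esub> Q_action t"
      by simp
  qed (use in_auto in \<open>simp add: AutoGroup_def\<close>)
qed

end

theory Submission
  imports Defs
begin

text \<open>
  Modulo \<open>sigma\<close>, that is, up to finitely many points, an element \<open>f\<close> of \<open>PO\<close> has a simple shape: possibly
  after the reflection in the diagonal, it shifts each row \<open>y\<close> along itself by some \<open>k y\<close> to the left and
  each column \<open>x\<close> along itself by some \<open>l x\<close> down, where \<open>k\<close> and \<open>l\<close> are decreasing and eventually zero.
  Such sequences are partitions, and adding two of them is adding the multisets of their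
  jumps; so the pairs \<open>(k, l)\<close> form the free commutative monoid in which \<open>gen_a i\<close> shifts the first \<open>i\<close>
  rows and \<open>gen_b j\<close> the first \<open>j\<close> columns by one.  The reflection exchanges rows and columns, hence
  acts by \<open>swap_letter\<close>.
  
  The shape is obtained from the weight \<open>x + y\<close> of a point \<open>(x, y)\<close>.  By monotonicity an antichain of the
  range pulls back to an antichain of the domain.  Applied to the points not above \<open>f p\<close>, whose
  preimages lie in the few rows and columns not above \<open>p\<close>, this shows that \<open>f\<close> does not increase weights
  (\<open>weight_le_weight\<close>).  As \<open>f\<close> is strictly monotone, the loss of weight decreases along rows and
  columns; as \<open>f\<close> is injective, only boundedly many points can cross a given level
  (\<open>card_crossing_le\<close>).  So there is no loss at all where both coordinates are large
  (\<open>weight_preserved_deep\<close>), and there unit steps go to unit steps, which makes \<open>f\<close> a translation along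
  the antidiagonal, up to the reflection (\<open>deep_translation\<close>).
  
  Each row ends up in a row, because the deep rows above it bound it and its loss of weight becomes
  constant; distinct rows go to distinct rows in increasing order.  Together with the same fact for
  columns, this makes the deep translation trivial and every row and column invariant far out
  (\<open>rows_normal_form\<close>, \<open>normal_form_if_translation\<close>).  Conversely every word is realized by an element of \<open>PO\<close>
  (\<open>ex_realizes\<close>), and the word and the reflection can be read off from far points
  (\<open>realizes_unique\<close>).  The map to the semidirect product defined in this way is a homomorphism
  (\<open>realizes_comp\<close>) whose kernel is \<open>sigma\<close>.
\<close>

section \<open>Cofinite parts of the grid\<close>

abbreviation grid :: "(nat \<times> nat) set" where
  "grid \<equiv> posnat \<times> posnat"

text \<open>
  The sets \<open>far N\<close> form a base of the filter of cofinite subsets of the grid, and each of them is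
  closed upwards, so that monotone maps can be followed along rows and columns inside them.
\<close>

definition far :: "nat \<Rightarrow> (nat \<times> nat) set" where
  "far N = {p \<in> grid. N \<le> fst p \<or> N \<le> snd p}"

fun weight :: "nat \<times> nat \<Rightarrow> nat" where
  "weight (x, y) = x + y"

lemma far_iff: "(x, y) \<in> far N \<longleftrightarrow> 0 < x \<and> 0 < y \<and> (N \<le> x \<or> N \<le> y)"
  by (auto simp: far_def posnat_def)

lemma far_antimono: "N \<le> M \<Longrightarrow> far M \<subseteq> far N"
  by (auto simp: far_def)

lemma finite_grid_minus_far: "finite (grid - far N)"
  by (rule finite_subset[of _ "{..N} \<times> {..N}"]) (auto simp: far_def)

lemma cofinite_contains_far:
  assumes "finite (grid - A)"
  shows "\<exists>N>0. far N \<subseteq> A"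
proof -
  obtain N where N: "\<forall>n \<in> weight ` (grid - A). n < N"
    using assms finite_nat_set_iff_bounded by blast
  have "far (Suc N) \<subseteq> A"
  proof
    fix p assume p: "p \<in> far (Suc N)"
    then have "N < weight p" "p \<in> grid" by (cases p; auto simp: far_def)+
    with N show "p \<in> A" by (meson DiffI image_eqI less_asym)
  qed
  then show ?thesis by blast
qed

lemma weight_le: "p \<le> q \<Longrightarrow> weight p \<le> weight q"
  by (cases p; cases q) auto

lemma eq_if_le_weight: "p \<le> q \<Longrightarrow> weight p = weight q \<Longrightarrow> p = q"
  by (cases p; cases q) auto

lemma finite_weight_le: "finite {q \<in> grid. weight q \<le> n}"
  by (rule finite_subset[of _ "{..n} \<times> {..n}"]) auto

lemma antitone_eventually_const:
  fixes g :: "nat \<Rightarrow> nat"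
  assumes "\<And>m n. N \<le> m \<Longrightarrow> m \<le> n \<Longrightarrow> g n \<le> g m"
  shows "\<exists>X\<ge>N. \<forall>n\<ge>X. g n = g X"
proof -
  obtain X where X: "X \<ge> N" "\<And>n. n \<ge> N \<Longrightarrow> g X \<le> g n"
    using ex_has_least_nat[of "\<lambda>n. n \<ge> N" N g] by blast
  then have "\<forall>n\<ge>X. g n = g X" using assms by (meson le_antisym le_trans)
  with X show ?thesis by blast
qed

section \<open>The normal form of a cofinite monotone injection\<close>

text \<open>
  The elements of \<open>PO\<close>, as total functions \<open>f\<close> considered on their domain \<open>D\<close> only.  Separating the
  domain from the function lets \<open>f\<close> be composed with the reflection \<open>prod.swap\<close> on either side.
\<close>

locale cofinite_monotone_map =
  fixes D :: "(nat \<times> nat) set" and f :: "nat \<times> nat \<Rightarrow> nat \<times> nat"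
  assumes dom_subset: "D \<subseteq> grid"
    and maps_to: "p \<in> D \<Longrightarrow> f p \<in> grid"
    and inj: "inj_on f D"
    and mono: "p \<in> D \<Longrightarrow> q \<in> D \<Longrightarrow> p \<le> q \<Longrightarrow> f p \<le> f q"
    and cofinite_dom: "finite (grid - D)"
    and cofinite_ran: "finite (grid - f ` D)"
begin

lemma weight_strict_mono:
  assumes "p \<in> D" "q \<in> D" "p \<le> q" "p \<noteq> q"
  shows "weight (f p) < weight (f q)"
proof -
  have "f p \<le> f q" "f p \<noteq> f q" using assms mono inj by (auto dest: inj_onD)
  then show ?thesis using weight_le eq_if_le_weight by (metis le_neq_implies_less)
qed

text \<open>
  The points of \<open>D\<close> that are not above \<open>p = (x, y)\<close> lie in \<open>x - 1\<close> columns and \<open>y - 1\<close> rows, and each of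
  these chains meets an antichain at most once.  A sufficiently high level set of the weight has
  \<open>(u - 1) + (v - 1)\<close> points not above \<open>f p = (u, v)\<close>, all in the range of \<open>f\<close>.  By monotonicity their
  preimages are pairwise incomparable and not above \<open>p\<close>, whence \<open>u + v \<le> x + y\<close>.
\<close>

lemma weight_le_weight:
  assumes p: "p \<in> D"
  shows "weight (f p) \<le> weight p"
proof -
  obtain x y where xy: "p = (x, y)" by (cases p)
  obtain u v where uv: "f p = (u, v)" by (cases "f p")
  have pos: "0 < x" "0 < y" "0 < u" "0 < v"
    using subsetD[OF dom_subset p] maps_to[OF p] uv by (auto simp: xy posnat_def)
  obtain M where M: "far M \<subseteq> f ` D" using cofinite_contains_far[OF cofinite_ran] by blast
  \<comment> \<open>The level is so high that its points in the columns below \<open>u\<close> are far out, hence in the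
    range, and differ from its points in the rows below \<open>v\<close>.\<close>
  define L where "L = M + u + v"
  define A where "A = (\<lambda>i. (i, L - i)) ` {1..<u} \<union> (\<lambda>j. (L - j, j)) ` {1..<v}"
  have "A \<subseteq> far M" by (auto simp: A_def far_iff L_def)
  then have A_ran: "A \<subseteq> f ` D" using M by blast
  have A_weight: "weight q = L" if "q \<in> A" for q using that by (auto simp: A_def L_def)
  have A_not_above: "\<not> f p \<le> q" if "q \<in> A" for q using that by (auto simp: A_def uv)
  have "card A = (u - 1) + (v - 1)"
    unfolding A_def
    by (subst card_Un_disjoint) (auto simp: card_image inj_on_def L_def)
  define P where "P = {r \<in> D. f r \<in> A}"
  have "f ` P = A" using A_ran by (auto simp: P_def)
  have inj_P: "inj_on f P" using inj by (rule inj_on_subset) (auto simp: P_def)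
  have incomparable: "r = s" if "r \<in> P" "s \<in> P" "r \<le> s" for r s
  proof (rule ccontr)
    assume "r \<noteq> s"
    then have "weight (f r) < weight (f s)" using that weight_strict_mono by (simp add: P_def)
    then show False using that A_weight by (simp add: P_def)
  qed
  have fin: "finite P"
    using \<open>f ` P = A\<close> inj_P finite_image_iff[of f P] by (simp add: A_def)
  have "card P = card A" using card_image[OF inj_P] \<open>f ` P = A\<close> by simp
  have P_cover: "P = {r \<in> P. fst r < x} \<union> {r \<in> P. snd r < y}"
  proof -
    have "fst r < x \<or> snd r < y" if "r \<in> P" for r
    proof (rule ccontr)
      assume "\<not> ?thesis"
      then have "p \<le> r" by (cases r) (auto simp: xy)
      then have "f p \<le> f r" using p that mono by (auto simp: P_def)
      then show False using A_not_above that by (auto simp: P_def)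
    qed
    then show ?thesis by auto
  qed
  have P_pos: "0 < fst r \<and> 0 < snd r" if "r \<in> P" for r
    using that subsetD[OF dom_subset, of r] by (cases r) (auto simp: P_def posnat_def)
  have "card {r \<in> P. fst r < x} \<le> card {1..<x}"
  proof (rule card_inj_on_le[of fst])
    show "inj_on fst {r \<in> P. fst r < x}"
    proof (rule inj_onI)
      fix r s assume "r \<in> {r \<in> P. fst r < x}" "s \<in> {r \<in> P. fst r < x}" "fst r = fst s"
      then show "r = s"
        using incomparable[of r s] incomparable[of s r] by (cases r; cases s) (auto dest: le_cases)
    qed
  qed (use P_pos in \<open>force+\<close>)
  moreover have "card {r \<in> P. snd r < y} \<le> card {1..<y}"
  proof (rule card_inj_on_le[of snd])
    show "inj_on snd {r \<in> P. snd r < y}"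
    proof (rule inj_onI)
      fix r s assume "r \<in> {r \<in> P. snd r < y}" "s \<in> {r \<in> P. snd r < y}" "snd r = snd s"
      then show "r = s"
        using incomparable[of r s] incomparable[of s r] by (cases r; cases s) (auto dest: le_cases)
    qed
  qed (use P_pos in \<open>force+\<close>)
  moreover have "card P \<le> card {r \<in> P. fst r < x} + card {r \<in> P. snd r < y}"
    using card_Un_le[of "{r \<in> P. fst r < x}" "{r \<in> P. snd r < y}"]
    unfolding P_cover[symmetric] .
  ultimately have "(u - 1) + (v - 1) \<le> (x - 1) + (y - 1)"
    using \<open>card P = card A\<close> \<open>card A = _\<close> by simp
  then have "u + v \<le> x + y" using pos by simp
  then show ?thesis unfolding uv unfolding xy by simp
qed

text \<open>
  Only boundedly many points drop from above a level \<open>n\<close> to or below it: the points of \<open>D\<close> of weight at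
  most \<open>n\<close> stay there, and they miss at most \<open>card (grid - D)\<close> of the available places.
\<close>

lemma card_crossing_le:
  "finite {p \<in> D. n < weight p \<and> weight (f p) \<le> n}"
  "card {p \<in> D. n < weight p \<and> weight (f p) \<le> n} \<le> card (grid - D)"
proof -
  let ?T = "{q \<in> grid. weight q \<le> n}" and ?S = "{p \<in> D. weight (f p) \<le> n}"
  let ?C = "{p \<in> D. n < weight p \<and> weight (f p) \<le> n}"
  have inj_S: "inj_on f ?S" using inj by (rule inj_on_subset) auto
  have img: "f ` ?S \<subseteq> ?T" using maps_to by blast
  have fin_S: "finite ?S"
    using inj_on_finite[OF inj_S img finite_weight_le] .
  then show "finite ?C" by (rule rev_finite_subset) auto
  have "card ?S \<le> card ?T" by (rule card_inj_on_le[OF inj_S img finite_weight_le])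
  also have "card ?T \<le> card (?T \<inter> D) + card (grid - D)"
  proof -
    have "card ?T \<le> card ((?T \<inter> D) \<union> (grid - D))"
      by (rule card_mono) (use finite_weight_le cofinite_dom in auto)
    then show ?thesis using card_Un_le le_trans by blast
  qed
  finally have "card ?S \<le> card (?T \<inter> D) + card (grid - D)" .
  moreover have "card ?S = card (?T \<inter> D) + card ?C"
  proof (subst card_Un_disjoint[symmetric])
    show "card ?S = card (?T \<inter> D \<union> ?C)"
      by (rule arg_cong[of _ _ card]) (use dom_subset weight_le_weight in \<open>force intro: le_trans\<close>)
  qed (use finite_weight_le \<open>finite ?C\<close> in auto)
  ultimately show "card ?C \<le> card (grid - D)" by linarith
qed

text \<open>
  Each unit step increases the weight of the image by at least one.  So the defect
  \<open>weight p - weight (f p)\<close>, which is nonnegative by \<open>weight_le_weight\<close>, decreases along rows and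
  columns in the far part.
\<close>

lemma weight_growth:
  assumes "far N \<subseteq> D" "(x, y) \<in> far N"
  shows "weight (f (x, y)) + i + j \<le> weight (f (x + i, y + j))"
proof -
  have F: "(x + i, y + j) \<in> D" for i j using assms by (auto simp: far_iff subset_iff)
  have 1: "weight (f (x, y)) + i \<le> weight (f (x + i, y))" for i
  proof (induction i)
    case (Suc i)
    have "weight (f (x + i, y)) < weight (f (x + Suc i, y))"
      by (rule weight_strict_mono) (use F[of i 0] F[of "Suc i" 0] in auto)
    with Suc show ?case by simp
  qed simp
  have "weight (f (x + i, y)) + j \<le> weight (f (x + i, y + j))"
  proof (induction j)
    case (Suc j)
    have "weight (f (x + i, y + j)) < weight (f (x + i, y + Suc j))"
      by (rule weight_strict_mono) (use F[of i] F[of i "Suc j"] in auto)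
    with Suc show ?case by simp
  qed simp
  with 1[of i] show ?thesis by simp
qed

text \<open>
  A point with positive defect and both coordinates at least \<open>K\<close> has more than \<open>card (grid - D)\<close>
  points of one level below it.  The defect being antitone, all of them drop below that level, which
  contradicts \<open>card_crossing_le\<close>.
\<close>

lemma weight_preserved_deep:
  assumes N: "far N \<subseteq> D" "0 < N" and K: "K = N + card (grid - D)" and "K \<le> x" "K \<le> y"
  shows "weight (f (x, y)) = x + y"
proof (rule ccontr)
  assume neq: "weight (f (x, y)) \<noteq> x + y"
  let ?c = "card (grid - D)"
  have "(x, y) \<in> D" using assms by (auto simp: far_iff subset_iff)
  then have lt: "weight (f (x, y)) < x + y" using neq weight_le_weight[of "(x, y)"] by simp
  let ?q = "\<lambda>i. (N + i, N + ?c - i)"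
  let ?C = "{p \<in> D. 2 * N + ?c - 1 < weight p \<and> weight (f p) \<le> 2 * N + ?c - 1}"
  have "?q ` {..?c} \<subseteq> ?C"
  proof
    fix p assume "p \<in> ?q ` {..?c}"
    then obtain i where i: "p = ?q i" "i \<le> ?c" by blast
    have pf: "p \<in> far N" using i \<open>0 < N\<close> by (auto simp: far_iff)
    have "weight (f p) + (x - (N + i)) + (y - (N + ?c - i)) \<le> weight (f (x, y))"
      using weight_growth[OF N(1) pf[unfolded i], of "x - (N + i)" "y - (N + ?c - i)"] i assms
      by simp
    then have "weight (f p) \<le> 2 * N + ?c - 1" using lt i assms by linarith
    then show "p \<in> ?C" using pf N i by auto
  qed
  then have "card (?q ` {..?c}) \<le> card ?C" by (rule card_mono[OF card_crossing_le(1)])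
  moreover have "card (?q ` {..?c}) = ?c + 1" by (subst card_image) (auto simp: inj_on_def)
  ultimately show False using card_crossing_le(2)[of "2 * N + ?c - 1"] by linarith
qed

text \<open>
  Where the weight is preserved, a unit step of the argument is a unit step of the image, to the right
  or upwards.  Injectivity forces the two steps from one point to have different directions, and a
  step to the right that stays a step to the right forces the same at both neighbouring points.  So the
  direction chosen at \<open>(K, K)\<close> is kept everywhere.
\<close>

lemma translation_of_first_step:
  assumes N: "far K \<subseteq> D" "0 < K"
    and W: "\<And>x y. K \<le> x \<Longrightarrow> K \<le> y \<Longrightarrow> weight (f (x, y)) = x + y"
    and ab: "f (K, K) = (a, b)" and first: "f (Suc K, K) = (Suc a, b)"
  shows "f (K + i, K + j) = (a + i, b + j)"
proof -
  have D: "(x, y) \<in> D" if "K \<le> x" "K \<le> y" for x y using that N by (auto simp: far_iff subset_iff)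
  have step1: "f (Suc x, y) = (Suc u, v) \<or> f (Suc x, y) = (u, Suc v)"
    if "K \<le> x" "K \<le> y" "f (x, y) = (u, v)" for x y u v
  proof -
    obtain u' v' where e: "f (Suc x, y) = (u', v')" by (cases "f (Suc x, y)")
    have "f (x, y) \<le> f (Suc x, y)" by (rule mono) (use that D in auto)
    then show ?thesis using that W[of x y] W[of "Suc x" y] e by auto
  qed
  have step2: "f (x, Suc y) = (Suc u, v) \<or> f (x, Suc y) = (u, Suc v)"
    if "K \<le> x" "K \<le> y" "f (x, y) = (u, v)" for x y u v
  proof -
    obtain u' v' where e: "f (x, Suc y) = (u', v')" by (cases "f (x, Suc y)")
    have "f (x, y) \<le> f (x, Suc y)" by (rule mono) (use that D in auto)
    then show ?thesis using that W[of x y] W[of x "Suc y"] e by auto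
  qed
  have neq: "f (x, y) \<noteq> f (x', y')" if "K \<le> x" "K \<le> y" "K \<le> x'" "K \<le> y'" "(x, y) \<noteq> (x', y')" for x y x' y'
    using that inj D by (meson inj_onD)
  let ?O = "\<lambda>x y u v. f (x, y) = (u, v) \<and> f (Suc x, y) = (Suc u, v)"
  have up: "f (x, Suc y) = (u, Suc v)" if "K \<le> x" "K \<le> y" "?O x y u v" for x y u v
    using step2[of x y u v] neq[of "Suc x" y x "Suc y"] that by auto
  have diag: "f (Suc x, Suc y) = (Suc u, Suc v)" if "K \<le> x" "K \<le> y" "?O x y u v" for x y u v
    using step1[of x "Suc y" u "Suc v"] step2[of "Suc x" y "Suc u" v] up[OF that] that by auto
  have right: "?O (Suc x) y (Suc u) v" if "K \<le> x" "K \<le> y" "?O x y u v" for x y u v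
    using step1[of "Suc x" y "Suc u" v] diag[OF that] neq[of "Suc (Suc x)" y "Suc x" "Suc y"] that by auto
  have above: "?O x (Suc y) u (Suc v)" if "K \<le> x" "K \<le> y" "?O x y u v" for x y u v
    using up[OF that] diag[OF that] by simp
  have "?O (K + i) K (a + i) b" by (induction i) (use ab first right in auto)
  then have "?O (K + i) (K + j) (a + i) (b + j)" by (induction j) (use above in auto)
  then show ?thesis by simp
qed

text \<open>
  The reflection is an automorphism of the grid.  Composition with it reduces an \<open>f\<close> that exchanges the
  two directions to one that keeps them; conjugation by it turns statements about rows into statements
  about columns.
\<close>

lemma swap_after: "cofinite_monotone_map D (prod.swap \<circ> f)"
proof
  show "inj_on (prod.swap \<circ> f) D" using inj by (simp add: comp_inj_on)
  show "finite (grid - (prod.swap \<circ> f) ` D)"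
  proof -
    have "grid - (prod.swap \<circ> f) ` D = prod.swap ` (grid - f ` D)"
      by (subst image_set_diff) (auto simp: image_comp product_swap)
    then show ?thesis using cofinite_ran by simp
  qed
qed (use dom_subset maps_to mono cofinite_dom in \<open>auto simp: less_eq_prod_def mem_Times_iff\<close>)

lemma swap_conjugate: "cofinite_monotone_map (prod.swap ` D) (prod.swap \<circ> f \<circ> prod.swap)"
proof
  show "inj_on (prod.swap \<circ> f \<circ> prod.swap) (prod.swap ` D)"
    using inj_on_imageI[of "prod.swap \<circ> f \<circ> prod.swap" prod.swap D] inj
    by (simp add: comp_assoc comp_inj_on)
  show "finite (grid - prod.swap ` D)"
  proof -
    have "grid - prod.swap ` D = prod.swap ` (grid - D)"
      by (subst image_set_diff) (auto simp: product_swap)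
    then show ?thesis using cofinite_dom by simp
  qed
  show "finite (grid - (prod.swap \<circ> f \<circ> prod.swap) ` prod.swap ` D)"
    using cofinite_monotone_map.cofinite_ran[OF swap_after] by (simp add: image_comp comp_assoc)
qed (use dom_subset maps_to mono in \<open>auto simp: less_eq_prod_def mem_Times_iff\<close>)

lemma deep_translation:
  shows "\<exists>K a b. 0 < K \<and> far K \<subseteq> D \<and> a + b = 2 * K \<and>
    ((\<forall>i j. f (K + i, K + j) = (a + i, b + j)) \<or> (\<forall>i j. (prod.swap \<circ> f) (K + i, K + j) = (a + i, b + j)))"
proof -
  obtain N where N: "0 < N" "far N \<subseteq> D" using cofinite_contains_far[OF cofinite_dom] by blast
  define K where "K = N + card (grid - D)"
  have K: "0 < K" "far K \<subseteq> D" using N far_antimono[of N K] by (auto simp: K_def)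
  have W: "weight (f (x, y)) = x + y" if "K \<le> x" "K \<le> y" for x y
    using weight_preserved_deep[OF N(2,1) K_def] that by blast
  obtain a b where ab: "f (K, K) = (a, b)" by (cases "f (K, K)")
  have sum: "a + b = 2 * K" using W[of K K] ab by simp
  obtain u v where uv: "f (Suc K, K) = (u, v)" by (cases "f (Suc K, K)")
  have "f (K, K) \<le> f (Suc K, K)" by (rule mono) (use K in \<open>auto simp: far_iff subset_iff\<close>)
  then have "(u, v) = (Suc a, b) \<or> (u, v) = (a, Suc b)" using W[of "Suc K" K] sum ab uv by auto
  then show ?thesis
  proof
    assume "(u, v) = (Suc a, b)"
    then have "\<forall>i j. f (K + i, K + j) = (a + i, b + j)"
      using translation_of_first_step[OF K(2,1) W ab] uv by simp
    then show ?thesis using K sum by blast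
  next
    assume *: "(u, v) = (a, Suc b)"
    have W': "weight ((prod.swap \<circ> f) (x, y)) = x + y" if "K \<le> x" "K \<le> y" for x y
      using W[OF that] by (cases "f (x, y)") simp
    have "\<forall>i j. (prod.swap \<circ> f) (K + i, K + j) = (b + i, a + j)"
      using cofinite_monotone_map.translation_of_first_step[OF swap_after K(2,1) W'] ab uv * by simp
    then show ?thesis using K sum by (metis add.commute)
  qed
qed

text \<open>
  Along a row the second coordinate of the image increases and is bounded by its value in the deep part
  above that row, and the defect decreases; both become constant.  So the row ends up as a tail of
  the row \<open>v\<close>, with defect \<open>e\<close>.
\<close>

lemma row_image:
  assumes K: "0 < K" "far K \<subseteq> D" and T: "\<And>i j. f (K + i, K + j) = (a + i, b + j)" and y: "0 < y"
  shows "\<exists>e v X. K \<le> X \<and> (\<forall>x\<ge>X. fst (f (x, y)) + v + e = x + y \<and> snd (f (x, y)) = v)"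
proof -
  have F: "(x, y') \<in> D" if "K \<le> x" "0 < y'" for x y' using that K by (auto simp: far_iff subset_iff)
  have bound: "snd (f (x, y)) \<le> b + y" if "K \<le> x" for x
  proof -
    have "f (x, y) \<le> f (x, K + y)" by (rule mono) (use F that y in auto)
    also have "f (x, K + y) = (a + (x - K), b + y)" using T[of "x - K" y] that by simp
    finally show ?thesis by (simp add: less_eq_prod_def)
  qed
  have "\<exists>X\<ge>K. \<forall>x\<ge>X. b + y - snd (f (x, y)) = b + y - snd (f (X, y))"
  proof (rule antitone_eventually_const)
    fix m n assume "K \<le> m" "m \<le> n"
    then have "f (m, y) \<le> f (n, y)" by (intro mono) (use F y in auto)
    then show "b + y - snd (f (n, y)) \<le> b + y - snd (f (m, y))" by (simp add: less_eq_prod_def diff_le_mono2)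
  qed
  then obtain X1 where X1: "X1 \<ge> K" "\<And>x. x \<ge> X1 \<Longrightarrow> snd (f (x, y)) = snd (f (X1, y))"
  proof -
    assume *: "\<And>X1. X1 \<ge> K \<Longrightarrow> (\<And>x. x \<ge> X1 \<Longrightarrow> snd (f (x, y)) = snd (f (X1, y))) \<Longrightarrow> thesis"
      and "\<exists>X\<ge>K. \<forall>x\<ge>X. b + y - snd (f (x, y)) = b + y - snd (f (X, y))"
    then obtain X where X: "X \<ge> K" "\<And>x. x \<ge> X \<Longrightarrow> b + y - snd (f (x, y)) = b + y - snd (f (X, y))"
      by blast
    have "snd (f (x, y)) = snd (f (X, y))" if "x \<ge> X" for x
      using X(2)[OF that] bound[of x] bound[of X] X(1) that by linarith
    with X(1) show thesis by (rule *)
  qed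
  have "\<exists>X\<ge>K. \<forall>x\<ge>X. x + y - weight (f (x, y)) = X + y - weight (f (X, y))"
  proof (rule antitone_eventually_const)
    fix m n assume "K \<le> m" "m \<le> n"
    then have "weight (f (m, y)) + (n - m) \<le> weight (f (n, y))"
      using weight_growth[OF K(2), of m y "n - m" 0] y K by (simp add: far_iff)
    then show "n + y - weight (f (n, y)) \<le> m + y - weight (f (m, y))" using \<open>m \<le> n\<close> by simp
  qed
  then obtain X2 where X2: "X2 \<ge> K"
    "\<And>x. x \<ge> X2 \<Longrightarrow> x + y - weight (f (x, y)) = X2 + y - weight (f (X2, y))" by blast
  have "\<forall>x\<ge>max X1 X2. fst (f (x, y)) + snd (f (X1, y)) + (X2 + y - weight (f (X2, y))) = x + y
      \<and> snd (f (x, y)) = snd (f (X1, y))"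
  proof (intro allI impI)
    fix x assume x: "max X1 X2 \<le> x"
    have "weight (f (x, y)) \<le> x + y" using weight_le_weight[of "(x, y)"] F[of x y] x X1(1) y by simp
    then have "weight (f (x, y)) + (X2 + y - weight (f (X2, y))) = x + y" using X2(2)[of x] x by linarith
    then show "fst (f (x, y)) + snd (f (X1, y)) + (X2 + y - weight (f (X2, y))) = x + y
      \<and> snd (f (x, y)) = snd (f (X1, y))" using X1(2)[of x] x by (cases "f (x, y)") simp
  qed
  then show ?thesis using X1(1) by (meson le_max_iff_disj)
qed

text \<open>
  Different rows end up in different rows, in the same order, so \<open>v y \<ge> y\<close>.  As \<open>v K = b\<close>, this bounds \<open>b\<close>
  from below; if \<open>b = K\<close>, it leaves no room and \<open>v\<close> is the identity, so that each row is shifted along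
  itself.  Rows above \<open>K\<close> are fixed far out because the translation is then trivial, and comparison of
  two rows far to the right shows that a higher row is shifted less.
\<close>

lemma rows_normal_form:
  assumes K: "0 < K" "far K \<subseteq> D" and T: "\<And>i j. f (K + i, K + j) = (a + i, b + j)" and sum: "a + b = 2 * K"
  shows "K \<le> b"
    and "b = K \<Longrightarrow> \<exists>k M. (\<forall>x\<ge>M. \<forall>y>0. f (x, y) = (x - k y, y)) \<and> (\<forall>y>0. \<forall>z\<ge>y. k z \<le> k y) \<and> (\<forall>y\<ge>M. k y = 0)"
proof -
  have F: "(x, y') \<in> D" if "K \<le> x" "0 < y'" for x y' using that K by (auto simp: far_iff subset_iff)
  obtain e v X where R: "\<And>y. 0 < y \<Longrightarrow> K \<le> X y"
    "\<And>y x. 0 < y \<Longrightarrow> X y \<le> x \<Longrightarrow> fst (f (x, y)) + v y + e y = x + y"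
    "\<And>y x. 0 < y \<Longrightarrow> X y \<le> x \<Longrightarrow> snd (f (x, y)) = v y"
    using row_image[OF K T] by metis
  have v_strict: "v y < v z" if "0 < y" "y < z" for y z
  proof -
    let ?x = "max (X y) (X z)"
    have "f (?x, y) \<le> f (?x, z)" by (rule mono) (use R(1)[of y] F that in auto)
    then have le: "v y \<le> v z" using R(3)[of y ?x] R(3)[of z ?x] that by (simp add: less_eq_prod_def)
    have "v y \<noteq> v z"
    proof
      assume eq: "v y = v z"
      \<comment> \<open>Two tails of one row meet: these arguments have the same image.\<close>
      define s where "s = ?x + z + e y"
      define t where "t = ?x + y + e z"
      have st: "X y \<le> s" "X z \<le> t" by (auto simp: s_def t_def)
      have "fst (f (s, y)) = fst (f (t, z))"
        using R(2)[of y s] R(2)[of z t] st that eq by (simp add: s_def t_def)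
      moreover have "snd (f (s, y)) = snd (f (t, z))"
        using R(3)[of y s] R(3)[of z t] st that eq by simp
      ultimately have "f (s, y) = f (t, z)" by (simp add: prod_eq_iff)
      moreover have "(s, y) \<in> D" "(t, z) \<in> D" using F R(1)[of y] R(1)[of z] st that by auto
      ultimately show False using inj that by (auto dest: inj_onD)
    qed
    with le show ?thesis by simp
  qed
  have v_deep: "v y + K = b + y" "e y = 0 \<or> b \<noteq> K" if y: "K \<le> y" for y
  proof -
    have "K \<le> X y" using R(1)[of y] y K(1) by simp
    then obtain i where i: "X y = K + i" using le_Suc_ex by blast
    obtain j where j: "y = K + j" using y le_Suc_ex by blast
    have "f (X y, y) = (a + i, b + j)" unfolding i unfolding j by (rule T)
    then show "v y + K = b + y" "e y = 0 \<or> b \<noteq> K"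
      using R(2)[of y "X y"] R(3)[of y "X y"] y K(1) i j sum by auto
  qed
  have "0 < v 1" using maps_to[of "(X 1, 1)"] F[of "X 1" 1] R(1)[of 1] R(3)[of 1 "X 1"]
    by (cases "f (X 1, 1)") (auto simp: posnat_def)
  have v_ge: "y \<le> v y" if "0 < y" for y
    using that
  proof (induction y rule: nat_induct_non_zero)
    case (Suc n) then show ?case using v_strict[of n "Suc n"] by simp
  qed (use \<open>0 < v 1\<close> in simp)
  show "K \<le> b" using v_ge[OF K(1)] v_deep[of K] by simp
  assume "b = K"
  have "v (K - n) \<le> K - n" if "n < K" for n
    using that
  proof (induction n)
    case 0 then show ?case using v_deep[of K] \<open>b = K\<close> by simp
  next
    case (Suc n)
    have "v (K - Suc n) < v (K - n)" by (rule v_strict) (use Suc.prems in auto)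
    then show ?case using Suc by simp
  qed
  then have "v y \<le> y" if "0 < y" "y \<le> K" for y using that by (metis diff_diff_cancel diff_less K(1))
  then have v_id: "v y = y" if "0 < y" for y
    using that v_ge v_deep(1)[of y] \<open>b = K\<close> by (metis add.commute add_left_cancel le_antisym linear)
  have row: "f (x, y) = (x - e y, y)" "e y \<le> x" if "0 < y" "X y \<le> x" for x y
    using R(2,3)[of y x] v_id[of y] that by (auto simp: prod_eq_iff)
  define M where "M = Max (insert K (X ` {..K}))"
  have M: "K \<le> M" "\<And>y. y \<le> K \<Longrightarrow> X y \<le> M"
    unfolding M_def by (rule Max_ge; simp)+
  have e0: "e y = 0" if "K \<le> y" for y using v_deep(2)[OF that] \<open>b = K\<close> by simp
  have "f (x, y) = (x - e y, y)" if "M \<le> x" "0 < y" for x y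
  proof (cases "y \<le> K")
    case True then show ?thesis using row[of y x] M(2)[of y] that by simp
  next
    case False
    then show ?thesis using T[of "x - K" "y - K"] e0[of y] M(1) that sum \<open>b = K\<close> by simp
  qed
  moreover have "e z \<le> e y" if "0 < y" "y \<le> z" for y z
  proof -
    let ?x = "max (X y) (X z)"
    have "f (?x, y) \<le> f (?x, z)" by (rule mono) (use R(1)[of y] F that in auto)
    then show ?thesis using row[of y ?x] row[of z ?x] that by auto
  qed
  moreover have "\<forall>y\<ge>M. e y = 0" using e0 M(1) by simp
  ultimately show "\<exists>k M. (\<forall>x\<ge>M. \<forall>y>0. f (x, y) = (x - k y, y)) \<and> (\<forall>y>0. \<forall>z\<ge>y. k z \<le> k y) \<and> (\<forall>y\<ge>M. k y = 0)"
    by blast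
qed

text \<open>
  Rows give \<open>b \<ge> K\<close> and columns give \<open>a \<ge> K\<close>; as the weight is preserved, the deep translation is trivial,
  and the normal forms of the rows and of the columns apply.
\<close>

lemma normal_form_if_translation:
  assumes K: "0 < K" "far K \<subseteq> D" and T: "\<And>i j. f (K + i, K + j) = (a + i, b + j)" and sum: "a + b = 2 * K"
  shows "\<exists>k l M. (\<forall>x y. (x, y) \<in> far M \<longrightarrow> f (x, y) = (x - k y, y - l x))
    \<and> (\<forall>y>0. \<forall>z\<ge>y. k z \<le> k y) \<and> (\<forall>x>0. \<forall>z\<ge>x. l z \<le> l x) \<and> (\<forall>y\<ge>M. k y = 0 \<and> l y = 0)"
proof -
  let ?g = "prod.swap \<circ> f \<circ> prod.swap"
  interpret C: cofinite_monotone_map "prod.swap ` D" ?g by (rule swap_conjugate)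
  have K': "far K \<subseteq> prod.swap ` D"
    using K(2) by (force simp: far_def image_iff posnat_def)
  have T': "?g (K + i, K + j) = (b + i, a + j)" for i j using T by simp
  have ab: "a = K" "b = K"
    using rows_normal_form(1)[OF K T sum] C.rows_normal_form(1)[OF K(1) K' T'] sum by simp_all
  obtain k M where k: "\<forall>x\<ge>M. \<forall>y>0. f (x, y) = (x - k y, y)" "\<forall>y>0. \<forall>z\<ge>y. k z \<le> k y" "\<forall>y\<ge>M. k y = 0"
    using rows_normal_form(2)[OF K T sum ab(2)] by blast
  obtain l M' where l: "\<forall>x\<ge>M'. \<forall>y>0. ?g (x, y) = (x - l y, y)" "\<forall>y>0. \<forall>z\<ge>y. l z \<le> l y" "\<forall>y\<ge>M'. l y = 0"
    using C.rows_normal_form(2)[OF K(1) K' T' _ ab(1)] sum by (metis add.commute)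
  have "f (x, y) = (x - k y, y - l x)" if "(x, y) \<in> far (max M M')" for x y
  proof (cases "max M M' \<le> x")
    case True then show ?thesis using k l that by (simp add: far_iff)
  next
    case False
    then have "M' \<le> y" "0 < x" "k y = 0" using that k by (auto simp: far_iff)
    then have "?g (y, x) = (y - l x, x)" using l(1) by blast
    then have "f (x, y) = (x, y - l x)" by (cases "f (x, y)") simp
    then show ?thesis using \<open>k y = 0\<close> by simp
  qed
  then show ?thesis using k(2,3) l(2,3) by (metis max.boundedE)
qed

end

section \<open>Words as shifts\<close>

text \<open>
  The letter \<open>gen_a i\<close> acts by shifting each of the rows \<open>1, \<dots>, i\<close> by one step to the left, the letter
  \<open>gen_b j\<close> by shifting each of the columns \<open>1, \<dots>, j\<close> by one step down.  So \<open>row_shift w\<close> is the partition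
  conjugate to that of the indices of the letters \<open>gen_a i\<close> in \<open>w\<close>.
\<close>

definition row_shift :: "letter multiset \<Rightarrow> nat \<Rightarrow> nat" where
  "row_shift w y = size {#g \<in># w. \<exists>i\<ge>y. g = gen_a i#}"

abbreviation col_shift :: "letter multiset \<Rightarrow> nat \<Rightarrow> nat" where
  "col_shift w \<equiv> row_shift (image_mset swap_letter w)"

text \<open>
  The subtractions are meant for far points only, where they do not truncate and where at
  most one of the two shifts is nonzero.
\<close>

definition shift :: "letter multiset \<Rightarrow> nat \<times> nat \<Rightarrow> nat \<times> nat" where
  "shift w = (\<lambda>(x, y). (x - row_shift w y, y - col_shift w x))"

definition turn :: "int \<Rightarrow> nat \<times> nat \<Rightarrow> nat \<times> nat" where
  "turn t = (if t = 0 then id else prod.swap)"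

text \<open>
  The shift comes first and the reflection second: maps act on the right, and in the semidirect
  product \<open>(w, t)\<close> is the product of \<open>(w, 0)\<close> and \<open>({#}, t)\<close>, in this order.
\<close>

definition realizes :: "(nat \<times> nat \<rightharpoonup> nat \<times> nat) \<Rightarrow> letter multiset \<Rightarrow> int \<Rightarrow> bool" where
  "realizes \<alpha> w t \<longleftrightarrow> (\<exists>N. \<forall>p\<in>far N. \<alpha> p = Some (turn t (shift w p)))"

lemma row_shift_add: "row_shift (v + w) y = row_shift v y + row_shift w y"
  by (simp add: row_shift_def)

lemma row_shift_antitone: "y \<le> z \<Longrightarrow> row_shift w z \<le> row_shift w y"
  unfolding row_shift_def by (intro size_mset_mono filter_mset_mono_strong) auto

text \<open>
  The exponent of a letter is the jump of the shift function, which makes a word recoverable from its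
  shifts.
\<close>

lemma row_shift_eq_count: "row_shift w y = count w (gen_a y) + row_shift w (Suc y)"
proof (induction w)
  case (add g w)
  then show ?case by (cases g) (auto simp: row_shift_def le_Suc_eq Suc_le_eq order.order_iff_strict)
qed (simp add: row_shift_def)

lemma count_image_swap_letter: "count (image_mset swap_letter w) (gen_a y) = count w (gen_b y)"
proof (induction w)
  case (add g w)
  then show ?case by (cases g) auto
qed simp

lemma image_swap_letter_twice: "image_mset swap_letter (image_mset swap_letter w) = w"
  by (simp add: multiset.map_comp comp_def)

lemma row_shift_eventually_0: "\<exists>B. \<forall>y\<ge>B. row_shift w y = 0"
proof (induction w)
  case (add g w)
  then obtain B where B: "\<forall>y\<ge>B. row_shift w y = 0" by blast
  show ?case
  proof (cases g)
    case (gen_a i)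
    then have "\<forall>y\<ge>max B (Suc i). row_shift (add_mset g w) y = 0" using B by (auto simp: row_shift_def)
    then show ?thesis by blast
  next
    case (gen_b i)
    then have "\<forall>y\<ge>B. row_shift (add_mset g w) y = 0" using B by (auto simp: row_shift_def)
    then show ?thesis by blast
  qed
qed (simp add: row_shift_def)

lemma row_shift_le_size: "row_shift w y \<le> size w"
  by (simp add: row_shift_def size_filter_mset_lesseq)

lemma shift_bound:
  obtains B where "0 < B" "\<And>y. B \<le> y \<Longrightarrow> row_shift w y = 0" "\<And>x. B \<le> x \<Longrightarrow> col_shift w x = 0"
    "\<And>y. row_shift w y \<le> B" "\<And>x. col_shift w x \<le> B"
proof -
  obtain B1 where B1: "\<forall>y\<ge>B1. row_shift w y = 0" using row_shift_eventually_0 by blast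
  obtain B2 where B2: "\<forall>y\<ge>B2. col_shift w y = 0" using row_shift_eventually_0 by blast
  have s: "row_shift w y \<le> size w" "col_shift w y \<le> size w" for y
    using row_shift_le_size[of w] row_shift_le_size[of "image_mset swap_letter w"] by simp_all
  show thesis
  proof (rule that)
    show "0 < Suc (B1 + B2 + size w)" by simp
    show "row_shift w y \<le> Suc (B1 + B2 + size w)" for y using s(1)[of y] by linarith
    show "col_shift w y \<le> Suc (B1 + B2 + size w)" for y using s(2)[of y] by linarith
  qed (use B1 B2 in auto)
qed

lemma eq_if_shifts_eq:
  assumes "v \<in> carrier AM" "w \<in> carrier AM"
    and row: "\<And>y. 0 < y \<Longrightarrow> row_shift v y = row_shift w y"
    and col: "\<And>x. 0 < x \<Longrightarrow> col_shift v x = col_shift w x"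
  shows "v = w"
proof (rule multiset_eqI)
  fix g
  have zero: "count u (gen_a 0) = 0" "count u (gen_b 0) = 0" if "u \<in> carrier AM" for u
    using that by (auto simp: AM_simps posnat_def count_eq_zero_iff)
  show "count v g = count w g"
  proof (cases g)
    case (gen_a i)
    show ?thesis
    proof (cases "i = 0")
      case False
      then show ?thesis
        using row[of i] row[of "Suc i"] row_shift_eq_count[of v i] row_shift_eq_count[of w i] gen_a by simp
    qed (use gen_a zero assms in simp)
  next
    case (gen_b i)
    show ?thesis
    proof (cases "i = 0")
      case False
      then show ?thesis
        using col[of i] col[of "Suc i"] gen_b count_image_swap_letter[of v i] count_image_swap_letter[of w i]
          row_shift_eq_count[of "image_mset swap_letter v" i] row_shift_eq_count[of "image_mset swap_letter w" i]
        by simp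
    qed (use gen_b zero assms in simp)
  qed
qed

lemma row_shift_replicate: "row_shift (replicate_mset m (gen_a i)) y = (if y \<le> i then m else 0)"
  by (induction m) (auto simp: row_shift_def)

text \<open>
  The jumps of \<open>k\<close> are the exponents of the word; the sum of those from \<open>y\<close> on telescopes to \<open>k y\<close>.
\<close>

lemma ex_row_shift:
  fixes k :: "nat \<Rightarrow> nat"
  assumes anti: "\<And>y z. 0 < y \<Longrightarrow> y \<le> z \<Longrightarrow> k z \<le> k y" and zero: "\<And>y. M \<le> y \<Longrightarrow> k y = 0"
  shows "\<exists>w. set_mset w \<subseteq> gen_a ` posnat \<and> (\<forall>y>0. row_shift w y = k y)"
proof -
  let ?W = "\<lambda>n. \<Sum>i=1..n. replicate_mset (k i - k (Suc i)) (gen_a i)"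
  have "row_shift (?W n) y = (if y \<le> n then k y - k (Suc n) else 0)" if "0 < y" for n y
  proof (induction n)
    case 0
    then show ?case using that by (simp add: row_shift_def)
  next
    case (Suc n)
    have "row_shift (?W (Suc n)) y = row_shift (?W n) y + (if y \<le> Suc n then k (Suc n) - k (Suc (Suc n)) else 0)"
      by (simp add: row_shift_add row_shift_replicate)
    then show ?case using Suc anti[of y "Suc n"] anti[of "Suc n" "Suc (Suc n)"] that by (auto simp: le_Suc_eq)
  qed
  then have "\<forall>y>0. row_shift (?W M) y = k y" using zero by auto
  moreover have "set_mset (?W M) \<subseteq> gen_a ` posnat"
    by (auto simp: set_mset_sum posnat_def split: if_splits)
  ultimately show ?thesis by blast
qed

lemma col_shift_only_a: "set_mset w \<subseteq> range gen_a \<Longrightarrow> col_shift w x = 0"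
  by (auto simp: row_shift_def)

lemma ex_word_with_shifts:
  fixes k l :: "nat \<Rightarrow> nat"
  assumes "\<And>y z. 0 < y \<Longrightarrow> y \<le> z \<Longrightarrow> k z \<le> k y" "\<And>y. M \<le> y \<Longrightarrow> k y = 0"
    and "\<And>x z. 0 < x \<Longrightarrow> x \<le> z \<Longrightarrow> l z \<le> l x" "\<And>x. M \<le> x \<Longrightarrow> l x = 0"
  shows "\<exists>w\<in>carrier AM. (\<forall>y>0. row_shift w y = k y) \<and> (\<forall>x>0. col_shift w x = l x)"
proof -
  obtain u where u: "set_mset u \<subseteq> gen_a ` posnat" "\<forall>y>0. row_shift u y = k y"
    using ex_row_shift[of k M] assms by blast
  obtain v where v: "set_mset v \<subseteq> gen_a ` posnat" "\<forall>y>0. row_shift v y = l y"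
    using ex_row_shift[of l M] assms by blast
  have c: "col_shift u x = 0" "col_shift v x = 0" for x
    using u v by (auto intro!: col_shift_only_a)
  let ?w = "u + image_mset swap_letter v"
  have "swap_letter ` set_mset v \<subseteq> gen_b ` posnat" using v(1) by auto
  then have "?w \<in> carrier AM" using u(1) unfolding AM_simps by auto
  moreover have "\<forall>y>0. row_shift ?w y = k y" using u c by (simp add: row_shift_add)
  moreover have "\<forall>x>0. col_shift ?w x = l x"
    using v c by (simp add: row_shift_add image_swap_letter_twice)
  ultimately show ?thesis by blast
qed

lemma turn_far_iff: "turn t p \<in> far N \<longleftrightarrow> p \<in> far N"
  by (cases p) (auto simp: turn_def far_iff)

lemma turn_eq_iff: "turn t p = turn t q \<longleftrightarrow> p = q"
  by (cases p; cases q) (auto simp: turn_def)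

lemma turn_le_iff: "turn t p \<le> turn t q \<longleftrightarrow> p \<le> q"
  by (cases p; cases q) (auto simp: turn_def)

lemma turn_turn: "t = 0 \<or> t = 1 \<Longrightarrow> s = 0 \<or> s = 1 \<Longrightarrow> turn t (turn s p) = turn ((s + t) mod 2) p"
  by (auto simp: turn_def)

lemma shift_mono: "p \<le> q \<Longrightarrow> shift w p \<le> shift w q"
  by (cases p; cases q) (auto simp: shift_def intro: diff_le_mono2 diff_le_mono row_shift_antitone le_trans[OF diff_le_mono diff_le_mono2])

text \<open>
  Moving the reflection past a shift exchanges rows and columns, that is, the letters \<open>gen_a i\<close> and
  \<open>gen_b i\<close>.  This is where the action in the semidirect product comes from.
\<close>

lemma shift_turn:
  "shift w (turn t p) = turn t (shift (if t = 0 then w else image_mset swap_letter w) p)"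
  by (cases p) (simp add: turn_def shift_def image_swap_letter_twice)

text \<open>
  On \<open>far (2 * B)\<close>, with \<open>B\<close> bounding all shifts and the indices of all shifted lines, a shifted point
  stays at distance \<open>B\<close> from the axis towards which it moves.  Hence its image lies on the same shifted
  line and on no other, and adding the shifts back inverts the map.  Monotonicity holds because the
  shifts are antitone.
\<close>

lemma ex_realizes: "\<exists>\<alpha>\<in>PO_maps. realizes \<alpha> w t"
proof -
  obtain B where B: "0 < B" "\<And>y. B \<le> y \<Longrightarrow> row_shift w y = 0" "\<And>x. B \<le> x \<Longrightarrow> col_shift w x = 0"
    "\<And>y. row_shift w y \<le> B" "\<And>x. col_shift w x \<le> B"
    using shift_bound[of w] by metis
  let ?F = "far (2 * B)"
  let ?back = "\<lambda>(u, v). (u + row_shift w v, v + col_shift w u)"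
  define \<alpha> where "\<alpha> = (\<lambda>p. if p \<in> ?F then Some (turn t (shift w p)) else None)"
  have back_shift: "?back (shift w p) = p" if p: "p \<in> ?F" for p
  proof -
    obtain x y where xy: "p = (x, y)" by (cases p)
    have "row_shift w y \<le> x - B \<and> col_shift w x = 0 \<and> col_shift w (x - row_shift w y) = 0 \<or>
      col_shift w x \<le> y - B \<and> row_shift w y = 0 \<and> row_shift w (y - col_shift w x) = 0"
    proof (cases "2 * B \<le> x")
      case True then show ?thesis using B(2,3)[of x] B(4)[of y] B(3)[of "x - row_shift w y"] by auto
    next
      case False
      then have "2 * B \<le> y" using p xy by (simp add: far_iff)
      then show ?thesis using B(2)[of y] B(5)[of x] B(2)[of "y - col_shift w x"] by auto
    qed
    then show ?thesis by (auto simp: xy shift_def)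
  qed
  have shift_back: "shift w (?back q) = q" "?back q \<in> ?F" if q: "q \<in> ?F" for q
  proof -
    obtain u v where uv: "q = (u, v)" by (cases q)
    show "?back q \<in> ?F" using q by (auto simp: uv far_iff)
    show "shift w (?back q) = q"
    proof (cases "2 * B \<le> u")
      case True then show ?thesis using B(3)[of u] B(3)[of "u + row_shift w v"] by (auto simp: uv shift_def)
    next
      case False
      then have "2 * B \<le> v" using q uv by (simp add: far_iff)
      then show ?thesis using B(2)[of v] B(2)[of "v + col_shift w u"] by (auto simp: uv shift_def)
    qed
  qed
  have shift_grid: "shift w p \<in> grid" if p: "p \<in> ?F" for p
  proof -
    obtain x y where xy: "p = (x, y)" by (cases p)
    show ?thesis
    proof (cases "2 * B \<le> x")
      case True then show ?thesis using B(1) B(3)[of x] B(4)[of y] p by (auto simp: xy shift_def posnat_def far_iff)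
    next
      case False
      then have "2 * B \<le> y" using p xy by (simp add: far_iff)
      then show ?thesis using B(1) B(2)[of y] B(5)[of x] p by (auto simp: xy shift_def posnat_def far_iff)
    qed
  qed
  have dom: "dom \<alpha> = ?F" by (auto simp: \<alpha>_def dom_def)
  have ran: "ran \<alpha> = turn t ` shift w ` ?F"
  proof -
    have "\<alpha> p = Some q \<longleftrightarrow> p \<in> ?F \<and> q = turn t (shift w p)" for p q by (auto simp: \<alpha>_def)
    then show ?thesis unfolding ran_def image_image by blast
  qed
  have grid_far: "grid = far 0" by (auto simp: far_def)
  have "\<alpha> \<in> PO_maps"
    unfolding PO_maps_def
  proof (intro CollectI conjI)
    show "dom \<alpha> \<subseteq> grid" unfolding dom by (auto simp: far_def)
    show "ran \<alpha> \<subseteq> grid" unfolding ran using shift_grid turn_far_iff[of t _ 0] grid_far by blast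
    show "inj_on \<alpha> (dom \<alpha>)"
    proof (rule inj_onI)
      fix p q assume "p \<in> dom \<alpha>" "q \<in> dom \<alpha>" "\<alpha> p = \<alpha> q"
      then have pq: "p \<in> ?F" "q \<in> ?F" "shift w p = shift w q"
        unfolding dom by (simp_all add: \<alpha>_def turn_eq_iff)
      have "p = ?back (shift w p)" using pq(1) by (rule back_shift[symmetric])
      also have "\<dots> = q" unfolding pq(3) using pq(2) by (rule back_shift)
      finally show "p = q" .
    qed
    show "mono_on (dom \<alpha>) (\<lambda>x. the (\<alpha> x))"
      unfolding dom by (intro mono_onI) (simp add: \<alpha>_def turn_le_iff shift_mono)
    show "finite (grid - dom \<alpha>)" unfolding dom by (rule finite_grid_minus_far)
    have "?F \<subseteq> ran \<alpha>"
    proof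
      fix q assume q: "q \<in> ?F"
      have "turn t (turn t q) = q" by (cases q) (simp add: turn_def)
      moreover have "turn t q \<in> ?F" using q by (simp add: turn_far_iff)
      ultimately have "q = turn t (shift w (?back (turn t q)))" "?back (turn t q) \<in> ?F"
        using shift_back[of "turn t q"] by simp_all
      then show "q \<in> ran \<alpha>" unfolding ran by blast
    qed
    then show "finite (grid - ran \<alpha>)"
      by (rule finite_subset[OF Diff_mono[OF subset_refl] finite_grid_minus_far])
  qed
  moreover have "realizes \<alpha> w t" unfolding realizes_def by (rule exI[of _ "2 * B"]) (simp add: \<alpha>_def)
  ultimately show ?thesis by blast
qed

section \<open>The correspondence between maps and pairs\<close>

lemma PO_map_normal_form:
  assumes \<alpha>: "\<alpha> \<in> PO_maps"
  shows "\<exists>w\<in>carrier AM. \<exists>t\<in>{0, 1}. realizes \<alpha> w t"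
proof -
  define D where "D = dom \<alpha>"
  define f where "f = (\<lambda>p. the (\<alpha> p))"
  have some: "\<alpha> p = Some (f p)" if "p \<in> D" for p using that by (auto simp: D_def f_def)
  have "f ` D = ran \<alpha>" by (force simp: D_def f_def ran_def)
  moreover have "inj_on f D"
    using \<alpha> some by (auto simp: PO_maps_def inj_on_def D_def[symmetric])
  ultimately interpret cofinite_monotone_map D f
    using \<alpha> by unfold_locales (auto simp: PO_maps_def D_def[symmetric] f_def[symmetric] intro: mono_onD)
  have word: "\<exists>w\<in>carrier AM. \<exists>M. \<forall>p\<in>far M. p \<in> D \<and> g p = shift w p"
    if g: "cofinite_monotone_map D g" and K: "0 < K" "far K \<subseteq> D" "a + b = 2 * K"
      and T: "\<forall>i j. g (K + i, K + j) = (a + i, b + j)" for g K a b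
  proof -
    obtain k l M where *: "\<And>x y. (x, y) \<in> far M \<Longrightarrow> g (x, y) = (x - k y, y - l x)"
      "\<forall>y>0. \<forall>z\<ge>y. k z \<le> k y" "\<forall>x>0. \<forall>z\<ge>x. l z \<le> l x" "\<forall>y\<ge>M. k y = 0 \<and> l y = 0"
      using cofinite_monotone_map.normal_form_if_translation[OF g K(1,2) T[rule_format] K(3)] by metis
    obtain w where w: "w \<in> carrier AM" "\<forall>y>0. row_shift w y = k y" "\<forall>x>0. col_shift w x = l x"
      using ex_word_with_shifts[of k M l] * by blast
    have "p \<in> D \<and> g p = shift w p" if "p \<in> far (max M K)" for p
    proof -
      obtain x y where xy: "p = (x, y)" by (cases p)
      have "p \<in> far M" "p \<in> far K" using that far_antimono[of M "max M K"] far_antimono[of K "max M K"] by auto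
      then show ?thesis using *(1)[of x y] w K(2) by (auto simp: xy shift_def far_iff)
    qed
    then show ?thesis using w(1) by blast
  qed
  obtain K a b where K: "0 < K" "far K \<subseteq> D" "a + b = 2 * K"
    and or: "(\<forall>i j. f (K + i, K + j) = (a + i, b + j)) \<or> (\<forall>i j. (prod.swap \<circ> f) (K + i, K + j) = (a + i, b + j))"
    using deep_translation by blast
  from or show ?thesis
  proof
    assume "\<forall>i j. f (K + i, K + j) = (a + i, b + j)"
    then obtain w M where w: "w \<in> carrier AM" "\<forall>p\<in>far M. p \<in> D \<and> f p = shift w p"
      using word[OF cofinite_monotone_map_axioms K] by blast
    then have "realizes \<alpha> w 0" unfolding realizes_def turn_def using some by (intro exI[of _ M]) simp
    then show ?thesis using w(1) by blast
  next
    assume "\<forall>i j. (prod.swap \<circ> f) (K + i, K + j) = (a + i, b + j)"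
    then obtain w M where w: "w \<in> carrier AM" "\<forall>p\<in>far M. p \<in> D \<and> (prod.swap \<circ> f) p = shift w p"
      using word[OF swap_after K] by blast
    then have "\<forall>p\<in>far M. p \<in> D \<and> f p = prod.swap (shift w p)" by (metis comp_apply swap_swap)
    then have "realizes \<alpha> w 1" unfolding realizes_def turn_def using some by (intro exI[of _ M]) simp
    then show ?thesis using w(1) by blast
  qed
qed

text \<open>
  A point far out in a row is moved along that row only, and it stays so far out that the second shift
  does the same; likewise for columns.
\<close>

lemma shift_shift_eventually: "\<exists>N. \<forall>p\<in>far N. shift w (shift v p) = shift (v + w) p"
proof -
  obtain B where B: "0 < B" "\<And>y. B \<le> y \<Longrightarrow> row_shift v y = 0" "\<And>x. B \<le> x \<Longrightarrow> col_shift v x = 0"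
    "\<And>y. row_shift v y \<le> B" "\<And>x. col_shift v x \<le> B"
    using shift_bound[of v] by metis
  obtain C where C: "\<And>y. C \<le> y \<Longrightarrow> row_shift w y = 0" "\<And>x. C \<le> x \<Longrightarrow> col_shift w x = 0"
    using shift_bound[of w] by metis
  have "shift w (shift v (x, y)) = shift (v + w) (x, y)" if "(x, y) \<in> far (B + C)" for x y
  proof (cases "B + C \<le> x")
    case True
    then show ?thesis
      using B(3)[of x] C(2)[of x] C(2)[of "x - row_shift v y"] B(4)[of y]
      by (simp add: shift_def row_shift_add)
  next
    case False
    then have "B + C \<le> y" using that by (simp add: far_iff)
    then show ?thesis
      using B(2)[of y] C(1)[of y] C(1)[of "y - col_shift v x"] B(5)[of x]
      by (simp add: shift_def row_shift_add)
  qed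
  then show ?thesis by (metis prod.exhaust)
qed

text \<open>
  Apart from \<open>shift_turn\<close> and \<open>shift_shift_eventually\<close>, the point is that an injective map sends only
  finitely many points outside of \<open>far N\<close>, so the description of \<open>\<beta>\<close> applies to almost all values of \<open>\<alpha>\<close>.
\<close>

lemma realizes_comp:
  assumes \<alpha>: "\<alpha> \<in> PO_maps" and v: "realizes \<alpha> v s" and w: "realizes \<beta> w t"
    and st: "s \<in> {0, 1}" "t \<in> {0, 1}" and "w \<in> carrier AM"
  shows "realizes (\<beta> \<circ>\<^sub>m \<alpha>) (v + Q_action s w) ((s + t) mod 2)"
proof -
  obtain N1 where N1: "\<forall>p\<in>far N1. \<alpha> p = Some (turn s (shift v p))" using v by (auto simp: realizes_def)
  obtain N2 where N2: "\<forall>p\<in>far N2. \<beta> p = Some (turn t (shift w p))" using w by (auto simp: realizes_def)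
  have Q: "Q_action s w = (if s = 0 then w else image_mset swap_letter w)"
    using assms by (auto simp: Q_action_def AM_swap_def)
  obtain N3 where N3: "\<forall>p\<in>far N3. shift (Q_action s w) (shift v p) = shift (v + Q_action s w) p"
    using shift_shift_eventually by blast
  have "finite {p. \<exists>q\<in>grid - far N2. \<alpha> p = Some q}"
    by (rule PO_maps_finite_vimage[OF \<alpha> finite_grid_minus_far])
  then have "finite (grid - (- {p. \<exists>q\<in>grid - far N2. \<alpha> p = Some q}))"
    by (rule rev_finite_subset) blast
  from cofinite_contains_far[OF this]
  obtain N4 where N4: "far N4 \<subseteq> - {p. \<exists>q\<in>grid - far N2. \<alpha> p = Some q}" by auto
  have "(\<beta> \<circ>\<^sub>m \<alpha>) p = Some (turn ((s + t) mod 2) (shift (v + Q_action s w) p))"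
    if p: "p \<in> far (Max {N1, N3, N4})" for p
  proof -
    have *: "p \<in> far N1" "p \<in> far N3" "p \<in> far N4"
      using p subsetD[OF far_antimono, of _ "Max {N1, N3, N4}" p] by simp_all
    have a: "\<alpha> p = Some (turn s (shift v p))" using N1 * by blast
    moreover have "ran \<alpha> \<subseteq> grid" using \<alpha> by (simp add: PO_maps_def)
    ultimately have in_grid: "turn s (shift v p) \<in> grid" using subsetD ranI by metis
    have "turn s (shift v p) \<in> far N2"
    proof (rule ccontr)
      assume "turn s (shift v p) \<notin> far N2"
      then have "\<exists>q\<in>grid - far N2. \<alpha> p = Some q" using in_grid a by (intro bexI DiffI)
      then show False using subsetD[OF N4 *(3)] by simp
    qed
    then have "(\<beta> \<circ>\<^sub>m \<alpha>) p = Some (turn t (shift w (turn s (shift v p))))" using N2 a by simp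
    also have "shift w (turn s (shift v p)) = turn s (shift (v + Q_action s w) p)"
      using N3 * by (simp add: shift_turn Q[symmetric])
    finally show ?thesis using turn_turn[of t s] st by simp
  qed
  then show ?thesis unfolding realizes_def by blast
qed

lemma realizes_cong:
  assumes "(\<alpha>, \<beta>) \<in> sigma" "realizes \<alpha> w t"
  shows "realizes \<beta> w t"
proof -
  obtain N1 where N1: "\<forall>p\<in>far N1. \<alpha> p = Some (turn t (shift w p))" using assms by (auto simp: realizes_def)
  have "finite (grid - {p. \<alpha> p = \<beta> p})"
    using assms(1) by (auto simp: sigma_iff_finite elim!: rev_finite_subset)
  from cofinite_contains_far[OF this] obtain N2 where "far N2 \<subseteq> {p. \<alpha> p = \<beta> p}" by auto
  then have "\<forall>p\<in>far (max N1 N2). \<beta> p = Some (turn t (shift w p))"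
    using N1 far_antimono[of N1 "max N1 N2"] far_antimono[of N2 "max N1 N2"] by fastforce
  then show ?thesis unfolding realizes_def by blast
qed

lemma sigma_if_realizes:
  assumes "\<alpha> \<in> PO_maps" "\<beta> \<in> PO_maps" "realizes \<alpha> w t" "realizes \<beta> w t"
  shows "(\<alpha>, \<beta>) \<in> sigma"
proof -
  obtain N1 where N1: "\<forall>p\<in>far N1. \<alpha> p = Some (turn t (shift w p))" using assms by (auto simp: realizes_def)
  obtain N2 where N2: "\<forall>p\<in>far N2. \<beta> p = Some (turn t (shift w p))" using assms by (auto simp: realizes_def)
  have "{p. \<alpha> p \<noteq> \<beta> p} \<subseteq> grid - far (max N1 N2)"
  proof
    fix p assume p: "p \<in> {p. \<alpha> p \<noteq> \<beta> p}"
    have "dom \<alpha> \<subseteq> grid" "dom \<beta> \<subseteq> grid" using assms by (simp_all add: PO_maps_def)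
    moreover have "p \<in> dom \<alpha> \<or> p \<in> dom \<beta>" using p by (cases "\<alpha> p"; cases "\<beta> p") auto
    moreover have "p \<notin> far (max N1 N2)"
      using p N1 N2 far_antimono[of N1 "max N1 N2"] far_antimono[of N2 "max N1 N2"] by fastforce
    ultimately show "p \<in> grid - far (max N1 N2)" by blast
  qed
  then show ?thesis using assms finite_grid_minus_far by (auto simp: sigma_iff_finite intro: finite_subset)
qed

text \<open>
  A point with both coordinates large is fixed by the shifts and shows whether there is a reflection;
  far points of a given row or column show its shift.
\<close>

lemma realizes_unique:
  assumes v: "realizes \<alpha> v s" "v \<in> carrier AM" "s \<in> {0, 1}"
    and w: "realizes \<alpha> w t" "w \<in> carrier AM" "t \<in> {0, 1}"
  shows "v = w \<and> s = t"
proof -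
  obtain N1 where N1: "\<forall>p\<in>far N1. \<alpha> p = Some (turn s (shift v p))" using v by (auto simp: realizes_def)
  obtain N2 where N2: "\<forall>p\<in>far N2. \<alpha> p = Some (turn t (shift w p))" using w by (auto simp: realizes_def)
  have eq: "turn s (shift v p) = turn t (shift w p)" if "p \<in> far (max N1 N2)" for p
  proof -
    have "p \<in> far N1" "p \<in> far N2"
      using that far_antimono[of N1 "max N1 N2"] far_antimono[of N2 "max N1 N2"] by auto
    then have "Some (turn s (shift v p)) = Some (turn t (shift w p))" using N1 N2 by metis
    then show ?thesis by simp
  qed
  obtain B where B: "\<And>y. B \<le> y \<Longrightarrow> row_shift v y = 0" "\<And>x. B \<le> x \<Longrightarrow> col_shift v x = 0"
    using shift_bound[of v] by metis
  obtain C where C: "\<And>y. C \<le> y \<Longrightarrow> row_shift w y = 0" "\<And>x. C \<le> x \<Longrightarrow> col_shift w x = 0"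
    using shift_bound[of w] by metis
  let ?n = "Suc (max N1 N2 + B + C)"
  \<comment> \<open>An off-diagonal point, moved by the reflection.\<close>
  have "(?n, Suc ?n) \<in> far (max N1 N2)" unfolding far_iff by linarith
  from eq[OF this] have "turn s (?n, Suc ?n) = turn t (?n, Suc ?n)"
    using B C by (simp add: shift_def)
  then have "s = t" using v w by (auto simp: turn_def split: if_splits)
  then have eq': "shift v p = shift w p" if "p \<in> far (max N1 N2)" for p
    using eq[OF that] by (simp add: turn_eq_iff)
  have "v = w"
  proof (rule eq_if_shifts_eq[OF v(2) w(2)])
    fix y :: nat assume "0 < y"
    let ?x = "Suc (max N1 N2 + row_shift v y + row_shift w y)"
    have "(?x, y) \<in> far (max N1 N2)" using \<open>0 < y\<close> unfolding far_iff by linarith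
    from eq'[OF this] show "row_shift v y = row_shift w y" by (simp add: shift_def)
  next
    fix x :: nat assume "0 < x"
    let ?y = "Suc (max N1 N2 + col_shift v x + col_shift w x)"
    have "(x, ?y) \<in> far (max N1 N2)" using \<open>0 < x\<close> unfolding far_iff by linarith
    from eq'[OF this] show "col_shift v x = col_shift w x" by (simp add: shift_def)
  qed
  with \<open>s = t\<close> show ?thesis by simp
qed

section \<open>The isomorphism\<close>

text \<open>
  The first isomorphism theorem, for semigroups.
\<close>

lemma quotient_semigroup_iso_image:
  assumes hom: "f \<in> hom S T" and surj: "f ` carrier S = carrier T"
    and closed: "\<And>x y. x \<in> carrier S \<Longrightarrow> y \<in> carrier S \<Longrightarrow> x \<otimes>\<^bsub>S\<^esub> y \<in> carrier S"
    and kernel: "\<And>x y. (x, y) \<in> r \<longleftrightarrow> x \<in> carrier S \<and> y \<in> carrier S \<and> f x = f y"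
  shows "quotient_semigroup S r \<cong> T"
proof -
  define h where "h A = the_elem (f ` A)" for A
  have cls: "r `` {x} = {y \<in> carrier S. f y = f x}" if "x \<in> carrier S" for x
    using that kernel by auto
  have h: "h (r `` {x}) = f x" if "x \<in> carrier S" for x
  proof -
    have "f ` (r `` {x}) = {f x}" using that by (auto simp: cls)
    then show ?thesis by (simp add: h_def)
  qed
  have mult: "r `` {x} \<otimes>\<^bsub>quotient_semigroup S r\<^esub> r `` {y} = r `` {x \<otimes>\<^bsub>S\<^esub> y}"
    if "x \<in> carrier S" "y \<in> carrier S" for x y
  proof -
    have prod: "r `` {a \<otimes>\<^bsub>S\<^esub> b} = r `` {x \<otimes>\<^bsub>S\<^esub> y}" if "a \<in> r `` {x}" "b \<in> r `` {y}" for a b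
      using that \<open>x \<in> carrier S\<close> \<open>y \<in> carrier S\<close> closed hom by (simp add: cls hom_mult)
    have mem: "x \<in> r `` {x}" "y \<in> r `` {y}" using that by (simp_all add: cls)
    have "r `` {x} \<otimes>\<^bsub>quotient_semigroup S r\<^esub> r `` {y}
        = (\<Union>a\<in>r `` {x}. \<Union>b\<in>r `` {y}. r `` {a \<otimes>\<^bsub>S\<^esub> b})"
      by (simp add: quotient_semigroup_def)
    also have "\<dots> = (\<Union>a\<in>r `` {x}. \<Union>b\<in>r `` {y}. r `` {x \<otimes>\<^bsub>S\<^esub> y})"
      by (intro SUP_cong refl prod)
    also have "\<dots> = r `` {x \<otimes>\<^bsub>S\<^esub> y}" using mem by blast
    finally show ?thesis .
  qed
  have carr: "carrier (quotient_semigroup S r) = (\<lambda>x. r `` {x}) ` carrier S"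
    by (auto simp: quotient_semigroup_def quotient_def)
  have "h \<in> hom (quotient_semigroup S r) T"
  proof (rule homI)
    fix A B assume "A \<in> carrier (quotient_semigroup S r)" "B \<in> carrier (quotient_semigroup S r)"
    then obtain x y where xy: "A = r `` {x}" "B = r `` {y}" "x \<in> carrier S" "y \<in> carrier S"
      unfolding carr by blast
    then show "h (A \<otimes>\<^bsub>quotient_semigroup S r\<^esub> B) = h A \<otimes>\<^bsub>T\<^esub> h B"
      using hom closed by (simp add: mult h hom_mult)
  qed (use surj h in \<open>auto simp: carr\<close>)
  moreover have "bij_betw h (carrier (quotient_semigroup S r)) (carrier T)"
    unfolding bij_betw_def
  proof
    show "inj_on h (carrier (quotient_semigroup S r))"
    proof (rule inj_onI)
      fix A B assume "A \<in> carrier (quotient_semigroup S r)" "B \<in> carrier (quotient_semigroup S r)"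
        and eq: "h A = h B"
      then obtain x y where "A = r `` {x}" "B = r `` {y}" "x \<in> carrier S" "y \<in> carrier S"
        unfolding carr by blast
      with eq show "A = B" using h[of x] h[of y] by (simp add: cls)
    qed
    show "h ` carrier (quotient_semigroup S r) = carrier T"
      unfolding carr surj[symmetric] by (auto simp: h image_iff)
  qed
  ultimately show ?thesis by (auto simp: is_iso_def iso_def)
qed

theorem theorem20:
  shows "quotient_semigroup PO sigma \<cong> semidirect_product AM (integer_mod_group 2) Q_action"
proof -
  let ?T = "semidirect_product AM (integer_mod_group 2) Q_action"
  define F where "F \<alpha> = (THE z. z \<in> carrier AM \<times> {0, 1} \<and> realizes \<alpha> (fst z) (snd z))" for \<alpha>
  have Z2: "carrier (integer_mod_group 2) = {0, 1}" by (auto simp: carrier_integer_mod_group)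
  have carr: "carrier ?T = carrier AM \<times> {0, 1}" by (simp add: semidirect_product_def Z2)
  have F_eq: "F \<alpha> = (w, t)" if "realizes \<alpha> w t" "w \<in> carrier AM" "t \<in> {0, 1}" for \<alpha> w t
    unfolding F_def
  proof (rule the_equality)
    fix z assume "z \<in> carrier AM \<times> {0, 1} \<and> realizes \<alpha> (fst z) (snd z)"
    then have "fst z = w \<and> snd z = t"
      using realizes_unique[OF _ _ _ that, of "fst z" "snd z"] by (simp add: mem_Times_iff)
    then show "z = (w, t)" by (simp add: prod_eq_iff)
  qed (use that in simp)
  have F_realizes: "\<exists>w t. F \<alpha> = (w, t) \<and> realizes \<alpha> w t \<and> w \<in> carrier AM \<and> t \<in> {0, 1}"
    if "\<alpha> \<in> PO_maps" for \<alpha>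
    using PO_map_normal_form[OF that] F_eq by blast
  show ?thesis
  proof (rule quotient_semigroup_iso_image[of F])
    show "F \<in> hom PO ?T"
    proof (rule homI)
      fix \<alpha> assume "\<alpha> \<in> carrier PO"
      then show "F \<alpha> \<in> carrier ?T" using F_realizes[of \<alpha>] by (auto simp: PO_simps carr)
    next
      fix \<alpha> \<beta> assume "\<alpha> \<in> carrier PO" "\<beta> \<in> carrier PO"
      then have in_PO: "\<alpha> \<in> PO_maps" "\<beta> \<in> PO_maps" by (simp_all add: PO_simps)
      obtain v s where v: "F \<alpha> = (v, s)" "realizes \<alpha> v s" "v \<in> carrier AM" "s \<in> {0, 1}"
        using F_realizes[OF in_PO(1)] by blast
      obtain w t where w: "F \<beta> = (w, t)" "realizes \<beta> w t" "w \<in> carrier AM" "t \<in> {0, 1}"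
        using F_realizes[OF in_PO(2)] by blast
      have "Q_action s w \<in> carrier AM" using w(3) AM_swap_closed by (simp add: Q_action_def)
      then have "v + Q_action s w \<in> carrier AM" using v(3) by (simp add: AM_simps)
      moreover have "(s + t) mod 2 \<in> {0, 1}" by auto
      ultimately have "F (\<beta> \<circ>\<^sub>m \<alpha>) = (v + Q_action s w, (s + t) mod 2)"
        by (rule F_eq[OF realizes_comp[OF in_PO(1) v(2) w(2) v(4) w(4) w(3)]])
      then show "F (\<alpha> \<otimes>\<^bsub>PO\<^esub> \<beta>) = F \<alpha> \<otimes>\<^bsub>?T\<^esub> F \<beta>"
        by (simp add: PO_simps v(1) w(1) semidirect_product_def AM_simps)
    qed
    show "F ` carrier PO = carrier ?T"
    proof
      show "F ` carrier PO \<subseteq> carrier ?T"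
        unfolding carr PO_simps using F_realizes by (intro image_subsetI) fastforce
      show "carrier ?T \<subseteq> F ` carrier PO"
      proof
        fix z assume "z \<in> carrier ?T"
        then obtain w t where z: "z = (w, t)" "w \<in> carrier AM" "t \<in> {0, 1}" unfolding carr by blast
        obtain \<alpha> where "\<alpha> \<in> PO_maps" "realizes \<alpha> w t" using ex_realizes by blast
        then show "z \<in> F ` carrier PO"
          unfolding PO_simps z(1) using F_eq[of \<alpha> w t] z(2,3) by (intro image_eqI[of _ F \<alpha>]) simp_all
      qed
    qed
    show "(\<alpha>, \<beta>) \<in> sigma \<longleftrightarrow> \<alpha> \<in> carrier PO \<and> \<beta> \<in> carrier PO \<and> F \<alpha> = F \<beta>" for \<alpha> \<beta>
    proof
      assume \<sigma>: "(\<alpha>, \<beta>) \<in> sigma"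
      then have in_PO: "\<alpha> \<in> PO_maps" "\<beta> \<in> PO_maps" by (simp_all add: sigma_iff_finite)
      obtain v s where v: "F \<alpha> = (v, s)" "realizes \<alpha> v s" "v \<in> carrier AM" "s \<in> {0, 1}"
        using F_realizes[OF in_PO(1)] by blast
      then have "F \<beta> = (v, s)" using F_eq realizes_cong[OF \<sigma>] by blast
      then show "\<alpha> \<in> carrier PO \<and> \<beta> \<in> carrier PO \<and> F \<alpha> = F \<beta>" using v(1) in_PO by (simp add: PO_simps)
    next
      assume *: "\<alpha> \<in> carrier PO \<and> \<beta> \<in> carrier PO \<and> F \<alpha> = F \<beta>"
      then have in_PO: "\<alpha> \<in> PO_maps" "\<beta> \<in> PO_maps" by (simp_all add: PO_simps)
      then obtain w t where "realizes \<alpha> w t" "realizes \<beta> w t"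
        using F_realizes[of \<alpha>] F_realizes[of \<beta>] * by auto
      then show "(\<alpha>, \<beta>) \<in> sigma" by (rule sigma_if_realizes[OF in_PO])
    qed
  qed (simp add: PO_simps PO_maps_comp)
qed

end
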